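(* Let $D_1,\dots,D_n$ be commuting $d\times d$ matrices with coefficients in $\mathbb{Z}$, all of them expanding. For $i=1,\dots,n$ let $\alpha_i\in\mathbb{R}^d$ and $h_i:\mathbb{T}^d\to\mathbb{T}^d$, $h_i(x)=D_i(x)+\alpha_i$. Assume that (the image in $\mathbb{T}^d$ of) the set $\{(\mathbb{I}_d-D_i)\alpha_j-(\mathbb{I}_d-D_j)\alpha_i: i,j\in\{1,\dots,n\}\}$ is not contained in any proper closed subgroup of $\mathbb{T}^d$. Let $\mu$ be a probability measure with $\operatorname{supp}\mu=\{h_1,\dots,h_n\}$, let $B=\{h_1,\dots,h_n\}^{\mathbb{N}}$ and let $\beta=\mu^{\otimes\mathbb{N}}$ be the product measure on $B$. Then for every $x\in\mathbb{T}^d$, for $\beta$-a.e. $b=(b_1,b_2,\dots)\in B$, $$\frac1N\sum_{k=0}^{N-1}\delta_{b_k\cdots b_1x}\ \longrightarrow\ \mathrm{Haar}\qquad (N\to\infty)$$ in the weak-$*$ topology.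
   Context: $\mathbb{T}^d=\mathbb{R}^d/\mathbb{Z}^d$, and Haar denotes the Haar probability measure on $\mathbb{T}^d$. A matrix is called expanding if all of its complex eigenvalues have modulus greater than $1$. An integer matrix $D$ also denotes the toral endomorphism $x\mapsto Dx\pmod{\mathbb{Z}^d}$; vectors in $\mathbb{R}^d$ are regarded as elements of $\mathbb{T}^d$ via reduction mod $\mathbb{Z}^d$. $\mathbb{I}_d$ is the identity matrix. The condition $\operatorname{supp}\mu=\{h_1,\dots,h_n\}$ means $\mu$ is concentrated on this finite set and gives positive mass to each $h_i$. The notation $b_k\cdots b_1x$ means $b_k\circ\cdots\circ b_1(x)$ (equal to $x$ when $k=0$), and $\delta_y$ is the Dirac mass at $y$. *)

theory Defs
  imports "HOL-Probability.Probability"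
begin

definition torus_rel :: "real ^ 'd \<Rightarrow> real ^ 'd \<Rightarrow> bool" where
  "torus_rel x y \<longleftrightarrow> (\<forall>i. (x - y) $ i \<in> \<int>)"

lemma equivp_torus_rel: "equivp (torus_rel :: real ^ 'd \<Rightarrow> real ^ 'd \<Rightarrow> bool)"
proof (rule equivpI)
  show "reflp (torus_rel :: real ^ 'd \<Rightarrow> _)"
    by (auto simp: reflp_def torus_rel_def)
  show "symp (torus_rel :: real ^ 'd \<Rightarrow> _)"
  proof (rule sympI)
    fix x y :: "real ^ 'd"
    assume "torus_rel x y"
    then have "- (x $ i - y $ i) \<in> \<int>" for i
      unfolding torus_rel_def by (intro Ints_minus) simp
    then show "torus_rel y x"
      by (simp add: torus_rel_def)
  qed
  show "transp (torus_rel :: real ^ 'd \<Rightarrow> _)"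
  proof (rule transpI)
    fix x y z :: "real ^ 'd"
    assume "torus_rel x y" "torus_rel y z"
    then have "(x $ i - y $ i) + (y $ i - z $ i) \<in> \<int>" for i
      unfolding torus_rel_def by (intro Ints_add) simp_all
    then show "torus_rel x z"
      by (simp add: torus_rel_def)
  qed
qed

quotient_type 'd torus = "real ^ ('d::finite)" / torus_rel
  morphisms torus_rep to_torus
  by (rule equivp_torus_rel)

lemma to_torus_eq_iff: "to_torus x = to_torus y \<longleftrightarrow> (\<forall>i. (x - y) $ i \<in> \<int>)"
  using torus.abs_eq_iff[of x y] by (simp add: torus_rel_def)

lemma torus_cases: obtains x where "z = to_torus x"
  using Quotient3_abs_rep[OF Quotient3_torus, of z] by metis

instantiation torus :: (finite) ab_group_add
begin

lift_definition zero_torus :: "'a torus" is 0 .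

lift_definition plus_torus :: "'a torus \<Rightarrow> 'a torus \<Rightarrow> 'a torus" is "(+)"
proof -
  fix x x' y y' :: "real ^ 'a"
  assume "torus_rel x x'" "torus_rel y y'"
  then have "(x $ i - x' $ i) + (y $ i - y' $ i) \<in> \<int>" for i
    unfolding torus_rel_def by (intro Ints_add) simp_all
  then show "torus_rel (x + y) (x' + y')"
    by (simp add: torus_rel_def algebra_simps)
qed

lift_definition uminus_torus :: "'a torus \<Rightarrow> 'a torus" is uminus
proof -
  fix x x' :: "real ^ 'a"
  assume "torus_rel x x'"
  then have "- (x $ i - x' $ i) \<in> \<int>" for i
    unfolding torus_rel_def by (intro Ints_minus) simp
  then show "torus_rel (- x) (- x')"
    by (simp add: torus_rel_def algebra_simps)
qed

definition minus_torus :: "'a torus \<Rightarrow> 'a torus \<Rightarrow> 'a torus" where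
  "minus_torus x y = x + - y"

instance
proof
  fix a b c :: "'a torus"
  show "a + b + c = a + (b + c)"
    by transfer (simp add: torus_rel_def algebra_simps)
  show "a + b = b + a"
    by transfer (simp add: torus_rel_def algebra_simps)
  show "0 + a = a"
    by transfer (simp add: torus_rel_def)
  show "- a + a = 0"
    by transfer (simp add: torus_rel_def)
  show "a - b = a + - b"
    by (rule minus_torus_def)
qed

end

instantiation torus :: (finite) topological_space
begin

definition open_torus :: "'a torus set \<Rightarrow> bool" where
  "open_torus U \<longleftrightarrow> open (to_torus -` U)"

instance
  by standard (auto simp: open_torus_def vimage_Union open_Int)

end

lemma to_torus_add: "to_torus (x + y) = to_torus x + to_torus y"
  by (simp add: plus_torus.abs_eq)

lemma continuous_on_to_torus: "continuous_on UNIV to_torus"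
  by (simp add: continuous_on_open_vimage open_torus_def)

lemma measurable_to_torus [measurable]: "to_torus \<in> borel_measurable borel"
  by (rule borel_measurable_continuous_onI[OF continuous_on_to_torus])

definition add_subgroup :: "'a::group_add set \<Rightarrow> bool" where
  "add_subgroup H \<longleftrightarrow> 0 \<in> H \<and> (\<forall>x\<in>H. \<forall>y\<in>H. x + y \<in> H) \<and> (\<forall>x\<in>H. - x \<in> H)"

definition expanding :: "int ^ 'd ^ 'd \<Rightarrow> bool" where
  "expanding D \<longleftrightarrow>
     (\<forall>(c::complex) v. v \<noteq> 0 \<and> map_matrix of_int D *v v = c *s v \<longrightarrow> norm c > 1)"

lift_definition toral_endo :: "int ^ 'd ^ 'd \<Rightarrow> 'd::finite torus \<Rightarrow> 'd torus"
  is "\<lambda>D x. map_matrix of_int D *v x"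
proof -
  fix D :: "int ^ 'd ^ 'd" and x y :: "real ^ 'd"
  assume "torus_rel x y"
  then have "(map_matrix of_int D *v (x - y)) $ i \<in> \<int>" for i
    by (auto simp: torus_rel_def matrix_vector_mult_def intro!: Ints_sum Ints_mult)
  then show "torus_rel (map_matrix of_int D *v x) (map_matrix of_int D *v y)"
    by (simp add: torus_rel_def matrix_vector_mult_diff_distrib)
qed

definition unit_cell :: "(real ^ 'd) set" where
  "unit_cell = {x. \<forall>i. 0 \<le> x $ i \<and> x $ i < 1}"

text \<open>That this is the Haar probability measure is shown by \<open>prob_space_haar\<close> and
  \<open>haar_translation_invariant\<close> below.\<close>

definition haar :: "'d::finite torus measure" where
  "haar = distr (restrict_space lborel unit_cell) borel to_torus"

definition dirac_average :: "(nat \<Rightarrow> 'a::topological_space) \<Rightarrow> nat \<Rightarrow> 'a measure" where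
  "dirac_average y N =
     measure_of UNIV (sets borel)
       (\<lambda>A. ennreal (1 / real N) * (\<Sum>k<N. emeasure (return borel (y k)) A))"

definition weak_star_conv :: "(nat \<Rightarrow> 'a::topological_space measure) \<Rightarrow> 'a measure \<Rightarrow> bool" where
  "weak_star_conv M L \<longleftrightarrow>
     (\<forall>f :: 'a \<Rightarrow> real. continuous_on UNIV f \<longrightarrow>
        (\<lambda>N. integral\<^sup>L (M N) f) \<longlonglongrightarrow> integral\<^sup>L L f)"

text \<open>Sequences of maps are indexed from \<open>0\<close>, so \<open>b k\<close> is the map applied at step \<open>k + 1\<close>.\<close>

primrec walk :: "(nat \<Rightarrow> 'a \<Rightarrow> 'a) \<Rightarrow> nat \<Rightarrow> 'a \<Rightarrow> 'a" where
  "walk b 0 x = x"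
| "walk b (Suc k) x = b k (walk b k x)"

lemma sets_haar [simp, measurable_cong]: "sets haar = sets borel"
  by (simp add: haar_def)

lemma space_haar [simp]: "space haar = UNIV"
  by (simp add: haar_def)

lemma unit_cell_borel [measurable]: "unit_cell \<in> sets borel"
proof -
  have "unit_cell = (\<Inter>i. {x :: real ^ 'd. 0 \<le> x $ i} \<inter> {x. x $ i < 1})"
    by (auto simp: unit_cell_def)
  also have "\<dots> \<in> sets borel"
    by (intro sets.finite_INT sets.Int borel_closed borel_open)
       (auto intro!: closed_Collect_le open_Collect_less continuous_intros)
  finally show ?thesis .
qed

lemma emeasure_haar:
  fixes A :: "'d::finite torus set"
  assumes "A \<in> sets borel"
  shows "emeasure haar A = emeasure lborel (to_torus -` A \<inter> unit_cell)"
proof -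
  have "(to_torus :: real ^ 'd \<Rightarrow> 'd torus) \<in> measurable (restrict_space lborel unit_cell) borel"
    by (intro measurable_restrict_space1) simp
  then show ?thesis
    unfolding haar_def using assms
    by (simp add: emeasure_distr emeasure_restrict_space space_restrict_space)
qed

lemma emeasure_unit_cell: "emeasure lborel (unit_cell :: (real ^ 'd) set) = 1"
proof -
  let ?z = "0 :: real ^ 'd" and ?o = "1 :: real ^ 'd"
  have o: "?o \<bullet> b = 1" if "b \<in> Basis" for b
    using that by (auto simp: Basis_vec_def inner_axis)
  have "box ?z ?o \<subseteq> unit_cell" "unit_cell \<subseteq> cbox ?z ?o"
    by (auto simp: unit_cell_def mem_box_cart less_imp_le)
  moreover have "emeasure lborel (box ?z ?o) = 1" "emeasure lborel (cbox ?z ?o) = 1"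
    by (auto simp: emeasure_lborel_box_eq emeasure_lborel_cbox_eq o)
  ultimately show ?thesis
    using emeasure_mono[of "box ?z ?o" unit_cell lborel]
      emeasure_mono[of unit_cell "cbox ?z ?o" lborel]
    by (simp add: order_antisym)
qed

lemma prob_space_haar: "prob_space (haar :: 'd::finite torus measure)"
  by (rule prob_spaceI) (simp add: emeasure_haar emeasure_unit_cell)

lemma emeasure_lborel_translate:
  fixes c :: "'a::euclidean_space"
  assumes "A \<in> sets borel"
  shows "emeasure lborel ((+) c -` A) = emeasure lborel A"
proof -
  have "emeasure lborel A = emeasure (distr lborel borel ((+) c)) A"
    by (simp add: lborel_distr_plus)
  then show ?thesis
    using assms by (simp add: emeasure_distr)
qed

definition int_vec :: "int ^ 'd \<Rightarrow> real ^ 'd" where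
  "int_vec z = (\<chi> i. of_int (z $ i))"

lemma unit_cell_translates_disjoint:
  assumes "x - int_vec z \<in> unit_cell" "x - int_vec z' \<in> unit_cell"
  shows "z = z'"
proof -
  have "z $ i = z' $ i" for i
  proof -
    have "0 \<le> x $ i - z $ i" "x $ i - z $ i < 1" "0 \<le> x $ i - z' $ i" "x $ i - z' $ i < 1"
      using assms by (auto simp: unit_cell_def int_vec_def)
    then show ?thesis by linarith
  qed
  then show ?thesis by (simp add: vec_eq_iff)
qed

lemma unit_cell_translates_cover: "\<exists>z. x - int_vec z \<in> unit_cell"
proof
  show "x - int_vec (\<chi> i. \<lfloor>x $ i\<rfloor>) \<in> unit_cell"
    by (auto simp: unit_cell_def int_vec_def) linarith
qed

lemma emeasure_decompose:
  fixes S :: "(real ^ 'd) set"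
  assumes [measurable]: "S \<in> sets borel"
  shows "emeasure lborel S =
    (\<integral>\<^sup>+z. emeasure lborel {y \<in> unit_cell. y + int_vec z \<in> S} \<partial>count_space UNIV)"
proof -
  let ?T = "\<lambda>z. {x. x - int_vec z \<in> unit_cell} \<inter> S"
  have T [measurable]: "?T z \<in> sets borel" for z
    by measurable
  have S: "S = (\<Union>z. ?T z)"
    using unit_cell_translates_cover by auto
  have "emeasure lborel S = (\<integral>\<^sup>+z. emeasure lborel (?T z) \<partial>count_space UNIV)"
    by (subst S, rule emeasure_UN_countable)
       (auto simp: disjoint_family_on_def dest: unit_cell_translates_disjoint)
  moreover have "emeasure lborel (?T z) = emeasure lborel {y \<in> unit_cell. y + int_vec z \<in> S}" for z
    by (subst emeasure_lborel_translate[symmetric, of _ "int_vec z"])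
       (auto simp: vimage_def add.commute intro!: arg_cong[where f = "emeasure lborel"])
  ultimately show ?thesis by simp
qed

lemma haar_translation_invariant:
  assumes A: "A \<in> sets borel"
  shows "emeasure haar ((+) a -` A) = emeasure haar (A :: 'd::finite torus set)"
proof -
  obtain c where c: "a = to_torus c" by (rule torus_cases)
  define P where "P = to_torus -` A"
  have P [measurable]: "P \<in> sets borel"
    using measurable_sets[OF measurable_to_torus A] by (simp add: P_def)
  have per: "x + int_vec z \<in> P \<longleftrightarrow> x \<in> P" for x z
  proof -
    have "to_torus (x + int_vec z) = to_torus x"
      by (simp add: to_torus_eq_iff int_vec_def)
    then show ?thesis by (simp add: P_def)
  qed
  have per': "x - int_vec z \<in> P \<longleftrightarrow> x \<in> P" for x z
    using per[of "x - int_vec z" z] by simp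
  have cont: "continuous_on UNIV ((+) a)"
    unfolding continuous_on_open_vimage[OF open_UNIV] open_torus_def
  proof safe
    fix U :: "'d torus set" assume "open (to_torus -` U)"
    then have "open ((+) c -` (to_torus -` U))"
      by (rule open_vimage) (intro continuous_intros)
    also have "(+) c -` (to_torus -` U) = to_torus -` ((+) a -` U \<inter> UNIV)"
      by (auto simp: c to_torus_add)
    finally show "open (to_torus -` ((+) a -` U \<inter> UNIV))" .
  qed
  have meas: "(+) a -` A \<in> sets borel"
    using measurable_sets[OF borel_measurable_continuous_onI[OF cont] A] by simp
  let ?Q = "unit_cell :: (real ^ 'd) set"
  have neg: "(\<integral>\<^sup>+z. g (- z) \<partial>count_space UNIV) = (\<integral>\<^sup>+z. g z \<partial>count_space UNIV)"
    for g :: "int ^ 'd \<Rightarrow> ennreal"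
    by (rule nn_integral_bij_count_space)
       (auto intro!: bij_betw_byWitness[where f' = uminus])
  define S where "S = {x. x - c \<in> ?Q \<and> x \<in> P}"
  have S [measurable]: "S \<in> sets borel"
    unfolding S_def by measurable
  define R where "R = {x. x + c \<in> ?Q \<and> x + c \<in> P}"
  have "emeasure haar ((+) a -` A) = emeasure lborel {x \<in> ?Q. c + x \<in> P}"
    using meas by (auto simp: emeasure_haar P_def c to_torus_add vimage_def
        intro!: arg_cong[where f = "emeasure lborel"])
  also have "\<dots> = emeasure lborel S"
    by (subst emeasure_lborel_translate[symmetric, of S c])
       (auto simp: S_def vimage_def intro!: arg_cong[where f = "emeasure lborel"])
  also have "\<dots> = (\<integral>\<^sup>+z. emeasure lborel {y \<in> ?Q. y + int_vec z - c \<in> ?Q \<and> y \<in> P} \<partial>count_space UNIV)"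
    by (subst emeasure_decompose) (simp_all add: S_def per)
  also have "\<dots> = (\<integral>\<^sup>+z. emeasure lborel {w \<in> ?Q. w + c - int_vec z \<in> ?Q \<and> w + c \<in> P} \<partial>count_space UNIV)"
  proof (rule nn_integral_cong)
    fix z :: "int ^ 'd"
    have [measurable]: "{y \<in> ?Q. y + int_vec z - c \<in> ?Q \<and> y \<in> P} \<in> sets borel"
      by measurable
    show "emeasure lborel {y \<in> ?Q. y + int_vec z - c \<in> ?Q \<and> y \<in> P} =
          emeasure lborel {w \<in> ?Q. w + c - int_vec z \<in> ?Q \<and> w + c \<in> P}"
      by (subst emeasure_lborel_translate[symmetric, of _ "c - int_vec z"])
         (auto simp: vimage_def algebra_simps per' intro!: arg_cong[where f = "emeasure lborel"]
          simp: per'[of "_ + c", unfolded add_diff_eq[symmetric]])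
  qed
  also have "\<dots> = (\<integral>\<^sup>+z. emeasure lborel {w \<in> ?Q. w + int_vec z + c \<in> ?Q \<and> w + int_vec z + c \<in> P} \<partial>count_space UNIV)"
  proof -
    have 1: "int_vec (- z) = - int_vec z" for z :: "int ^ 'd"
      by (simp add: int_vec_def vec_eq_iff)
    have 2: "w + (c + int_vec z) \<in> P \<longleftrightarrow> w + c \<in> P" for w z
      using per[of "w + c" z] by (simp add: algebra_simps)
    show ?thesis
      by (subst neg[symmetric]) (simp add: 1 2 algebra_simps)
  qed
  also have "\<dots> = emeasure lborel R"
    by (subst emeasure_decompose[of R]) (simp_all add: R_def)
  also have "\<dots> = emeasure lborel (P \<inter> ?Q)"
    by (subst emeasure_lborel_translate[symmetric, of "P \<inter> ?Q" c])
       (auto simp: R_def vimage_def add.commute intro!: arg_cong[where f = "emeasure lborel"])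
  also have "\<dots> = emeasure haar A"
    using A by (simp add: emeasure_haar P_def)
  finally show ?thesis .
qed

lemma dirac_average_eq_distr:
  "dirac_average y N = distr (uniform_count_measure {..<N}) borel y"
proof -
  have "ennreal (1 / real N) * (\<Sum>k<N. emeasure (return borel (y k)) A) =
      emeasure (distr (uniform_count_measure {..<N}) borel y) A" if "A \<in> sets borel" for A
  proof -
    have "emeasure (distr (uniform_count_measure {..<N}) borel y) A =
        ennreal (card (y -` A \<inter> {..<N}) / real N)"
      using that by (subst emeasure_distr)
        (auto simp: measurable_def space_uniform_count_measure sets_uniform_count_measure
          emeasure_uniform_count_measure)
    moreover have "(\<Sum>k<N. emeasure (return borel (y k)) A) = ennreal (card (y -` A \<inter> {..<N}))"
    proof -
      have "(\<Sum>k<N. emeasure (return borel (y k)) A) = (\<Sum>k<N. indicator (y -` A) k)"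
        using that by (auto intro!: sum.cong simp: indicator_def)
      also have "\<dots> = of_nat (card (y -` A \<inter> {..<N}))"
        by (simp add: indicator_def sum.If_cases vimage_def Int_def conj_commute)
      finally show ?thesis by (simp add: ennreal_of_nat_eq_real_of_nat)
    qed
    ultimately show ?thesis
      by (simp add: ennreal_mult[symmetric])
  qed
  then have "dirac_average y N = measure_of UNIV (sets borel)
      (emeasure (distr (uniform_count_measure {..<N}) borel y))"
    unfolding dirac_average_def
    by (intro measure_of_eq) (auto simp: sets.sigma_sets_eq[of borel, simplified])
  also have "\<dots> = distr (uniform_count_measure {..<N}) borel y"
    using measure_of_of_measure[of "distr (uniform_count_measure {..<N}) borel y"] by simp
  finally show ?thesis .
qed

lemma integral_dirac_average:
  fixes f :: "'a::topological_space \<Rightarrow> real"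
  assumes "f \<in> borel_measurable borel"
  shows "integral\<^sup>L (dirac_average y N) f = (\<Sum>k<N. f (y k)) / real N"
  unfolding dirac_average_eq_distr using assms
  by (subst integral_distr)
     (auto simp: measurable_def space_uniform_count_measure sets_uniform_count_measure
       integral_uniform_count_measure)

end

theory Submission
  imports Defs "HOL-Library.Discrete_Functions"
    "HOL-Computational_Algebra.Fundamental_Theorem_Algebra"
begin

text \<open>
  Weak-* convergence to Haar measure is tested on characters \<open>e\<^sub>m(z) = exp (2 \<pi> i m \<cdot> z)\<close>: for almost every
  \<open>b\<close>, the averages \<open>f\<^sub>N(m)\<close> of \<open>e\<^sub>m\<close> along the trajectory must tend to \<open>0\<close> for every nonzero integer
  vector \<open>m\<close>. Write \<open>x\<^sub>k\<close> for the trajectory. The variables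
  \<open>e\<^sub>m(x\<^sub>k\<^sub>+\<^sub>1)\<close> minus their conditional expectations are bounded and orthogonal, so their averages tend
  to \<open>0\<close> almost surely (\<open>AE_average_step\<close>). As the maps are affine, the conditional expectation is
  \<open>\<Sum>\<^sub>i p\<^sub>i exp (2 \<pi> i m \<cdot> \<alpha>\<^sub>i) e\<^bsub>m D\<^sub>i\<^esub>(x\<^sub>k)\<close>. Hence \<open>f\<^sub>N(m)\<close> and
  \<open>\<Sum>\<^sub>i p\<^sub>i exp (2 \<pi> i m \<cdot> \<alpha>\<^sub>i) f\<^sub>N(m D\<^sub>i)\<close> differ by \<open>o(1)\<close>, and from here on everything happens on the
  lattice of frequencies, on which the matrices act from the right; stationary measures never appear.

  Let \<open>F(m)\<close> be the upper limit of \<open>\<bar>f\<^sub>N(m)\<bar>\<close>. One step gives \<open>F(m) \<le> \<Sum>\<^sub>i p\<^sub>i F(m D\<^sub>i)\<close>. In two steps the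
  orders \<open>ij\<close> and \<open>ji\<close> lead to the same frequency, because the matrices commute, but with phases that
  differ by \<open>m \<cdot> c\<^sub>i\<^sub>j\<close>, where \<open>c\<^sub>i\<^sub>j = (1 - D\<^sub>i)\<alpha>\<^sub>j - (1 - D\<^sub>j)\<alpha>\<^sub>i\<close>. Averaging the two orders,
  \<open>F(m) \<le> \<Sum>\<^sub>i\<^sub>j p\<^sub>i p\<^sub>j \<bar>1 + exp (2 \<pi> i m \<cdot> c\<^sub>i\<^sub>j)\<bar>/2 F(m D\<^sub>i D\<^sub>j)\<close>.

  A maximum principle (\<open>vanishing_of_twisted_subharmonic\<close>) now forces \<open>F = 0\<close> off the origin. Suppose that
  the supremum of \<open>F\<close> there is positive. At a frequency where \<open>F\<close> is close to it, \<open>F\<close> is still close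
  to it after any bounded number of steps, and there the numbers \<open>m \<cdot> c\<^sub>i\<^sub>j\<close> have to be close to
  integers. Since the maximum of the \<open>F(m D\<^sub>i)\<close> is at least their weighted mean, \<open>F\<close> does not decrease along a
  suitable infinite path, and so this closeness persists along the whole path. But the
  matrices expand: a deviation from the nearest integer that is small and not zero grows along orbits
  until it is no longer small (\<open>small_along_path_imp_zero\<close>). So the \<open>m \<cdot> c\<^sub>i\<^sub>j\<close> are integers, and all \<open>c\<^sub>i\<^sub>j\<close> lie in
  the proper closed subgroup where \<open>e\<^sub>m = 1\<close>, contrary to the hypothesis.

  The growth of deviations comes from algebra. An expanding integer matrix satisfies an integer
  polynomial relation whose constant coefficient is at least twice the sum of the moduli of the others
  (\<open>expanding_dominated_relation\<close>). Deviations from the nearest integers inherit the relation up to an integer,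
  hence exactly once they are small, and then the first of them is at most half of the largest of the later ones.
\<close>

section \<open>An integer relation dominated by its constant term\<close>

text \<open>Row expansion holds over any commutative ring: replacing row \<open>i\<close> by the unit vectors
  and summing against row \<open>k\<close> puts row \<open>k\<close> in place of row \<open>i\<close>,
  which repeats a row unless \<open>k = i\<close>.\<close>

lemma adjugate_exists:
  fixes A :: "'a::comm_ring_1 ^ 'd ^ 'd"
  shows "\<exists>B :: 'a ^ 'd ^ 'd. \<forall>k i. (\<Sum>j\<in>UNIV. A $ k $ j * B $ j $ i) = (if k = i then det A else 0)"
proof (intro exI allI)
  fix k i :: 'd
  let ?B = "\<chi> j i. det (\<chi> r. if r = i then axis j 1 else row r A) :: 'a ^ 'd ^ 'd"
  have "(\<Sum>j\<in>UNIV. A $ k $ j * ?B $ j $ i)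
      = (\<Sum>j\<in>UNIV. det (\<chi> r. if r = i then A $ k $ j *s axis j 1 else row r A))"
    by (simp add: det_row_mul)
  also have "\<dots> = det (\<chi> r. if r = i then (\<Sum>j\<in>UNIV. A $ k $ j *s axis j 1) else row r A)"
    by (rule det_linear_row_sum[symmetric]) simp
  also have "(\<Sum>j\<in>UNIV. A $ k $ j *s axis j 1) = row k A"
    by (simp add: vec_eq_iff axis_def row_def if_distrib cong: if_cong)
  also have "det (\<chi> r. if r = i then row k A else row r A) = (if k = i then det A else 0)"
  proof (cases "k = i")
    case True
    then have "(\<chi> r. if r = i then row k A else row r A) = A"
      by (simp add: vec_eq_iff row_def)
    then show ?thesis using True by simp
  next
    case False
    then show ?thesis
      by (simp add: det_identical_rows[of i k] row_def vec_eq_iff)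
  qed
  finally show "(\<Sum>j\<in>UNIV. A $ k $ j * ?B $ j $ i) = (if k = i then det A else 0)" .
qed

definition charpoly :: "'a::comm_ring_1 ^ 'd ^ 'd \<Rightarrow> 'a poly" where
  "charpoly M = det (\<chi> i j. [: - M $ i $ j, if i = j then 1 else 0 :])"

lemma degree_charpoly: "degree (charpoly (M :: 'a::comm_ring_1 ^ 'd ^ 'd)) \<le> CARD('d)"
  unfolding charpoly_def det_def
proof (rule degree_sum_le)
  fix p :: "'d \<Rightarrow> 'd"
  let ?f = "\<lambda>i. (\<chi> i j. [: - M $ i $ j, if i = j then 1 else 0 :]) $ i $ p i"
  have "degree (of_int (sign p) * prod ?f UNIV) \<le> degree (of_int (sign p) :: 'a poly) + degree (prod ?f UNIV)"
    by (rule degree_mult_le)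
  also have "degree (prod ?f UNIV) \<le> sum (degree \<circ> ?f) UNIV"
    by (rule degree_prod_sum_le) simp
  also have "\<dots> \<le> (\<Sum>i\<in>(UNIV::'d set). 1)"
    by (rule sum_mono) (simp add: degree_pCons_eq_if)
  finally show "degree (of_int (sign p) * prod ?f UNIV) \<le> CARD('d)" by simp
qed simp

text \<open>Comparing coefficients in \<open>(X - M) adj (X - M) = charpoly M\<close> writes each term of
  \<open>charpoly M\<close> evaluated at \<open>M\<close> as a difference of consecutive values of one
  sequence. The row vector form is the one needed for the action on frequencies.\<close>

lemma cayley_hamilton:
  fixes M :: "'a::comm_ring_1 ^ 'd ^ 'd"
  assumes "degree (charpoly M) \<le> K"
  shows "(\<Sum>s\<le>K. coeff (charpoly M) s *s ((\<lambda>x. x v* M) ^^ s) m) = 0"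
proof -
  define x where "x s = ((\<lambda>x. x v* M) ^^ s) m" for s
  have xS: "x (Suc s) $ j = (\<Sum>k\<in>UNIV. x s $ k * M $ k $ j)" for s j
    by (simp add: x_def vector_matrix_mult_def mult.commute)
  obtain B :: "'a poly ^ 'd ^ 'd" where B:
    "\<And>k i. (\<Sum>j\<in>UNIV. [: - M $ k $ j, if k = j then 1 else 0 :] * B $ j $ i) = (if k = i then charpoly M else 0)"
    using adjugate_exists[of "\<chi> i j. [: - M $ i $ j, if i = j then 1 else 0 :]"]
    unfolding charpoly_def by auto
  have shift: "(if k = i then coeff (charpoly M) s else 0)
     = coeff (pCons 0 (B $ k $ i)) s - (\<Sum>j\<in>UNIV. M $ k $ j * coeff (B $ j $ i) s)" for k i s
  proof -
    have "(if k = i then coeff (charpoly M) s else 0)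
      = coeff (\<Sum>j\<in>UNIV. [: - M $ k $ j, if k = j then 1 else 0 :] * B $ j $ i) s"
      unfolding B by simp
    also have "\<dots> = (\<Sum>j\<in>UNIV. (if k = j then coeff (pCons 0 (B $ j $ i)) s else 0) - M $ k $ j * coeff (B $ j $ i) s)"
      unfolding coeff_sum by (rule sum.cong) (auto simp: coeff_pCons split: nat.split)
    finally show ?thesis by (simp add: sum_subtractf)
  qed
  \<comment> \<open>The column \<open>i\<close> of the adjugate coefficient at \<open>X ^ (s - 1)\<close>, paired with \<open>x s\<close>; the leading
    \<open>0\<close> of the \<open>pCons\<close> makes it vanish at \<open>s = 0\<close>.\<close>
  define G where "G i s = (\<Sum>k\<in>UNIV. x s $ k * coeff (pCons 0 (B $ k $ i)) s)" for i s
  have step: "coeff (charpoly M) s * x s $ i = G i s - G i (Suc s)" for s i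
  proof -
    have "coeff (charpoly M) s * x s $ i = (\<Sum>k\<in>UNIV. x s $ k * (if k = i then coeff (charpoly M) s else 0))"
      by (simp add: if_distrib mult.commute cong: if_cong)
    also have "\<dots> = G i s - (\<Sum>k\<in>UNIV. x s $ k * (\<Sum>j\<in>UNIV. M $ k $ j * coeff (B $ j $ i) s))"
      by (simp add: shift G_def right_diff_distrib sum_subtractf)
    also have "(\<Sum>k\<in>UNIV. x s $ k * (\<Sum>j\<in>UNIV. M $ k $ j * coeff (B $ j $ i) s)) = G i (Suc s)"
      unfolding G_def xS sum_distrib_left sum_distrib_right
      by (subst sum.swap) (simp add: mult.assoc)
    finally show ?thesis .
  qed
  have tele: "(\<Sum>s\<le>n. coeff (charpoly M) s * x s $ i) = - G i (Suc n)" for n i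
  proof -
    have "G i 0 = 0" by (simp add: G_def)
    moreover have "(\<Sum>s\<le>n. coeff (charpoly M) s * x s $ i) = G i 0 - G i (Suc n)"
      unfolding step by (rule sum_telescope)
    ultimately show ?thesis by simp
  qed
  have "(\<Sum>s\<le>K. coeff (charpoly M) s * x s $ i) = 0" for i
  proof -
    \<comment> \<open>Beyond the degrees of all adjugate entries the telescoped remainder is zero.\<close>
    define n where "n = K + Max (range (\<lambda>k. Suc (degree (B $ k $ i))))"
    have "degree (B $ k $ i) < n" for k
    proof -
      have "Suc (degree (B $ k $ i)) \<le> Max (range (\<lambda>k. Suc (degree (B $ k $ i))))"
        by (rule Max_ge) auto
      then show ?thesis unfolding n_def by linarith
    qed
    then have "G i (Suc n) = 0"
      by (simp add: G_def coeff_eq_0)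
    moreover have "(\<Sum>s\<le>n. coeff (charpoly M) s * x s $ i) = (\<Sum>s\<le>K. coeff (charpoly M) s * x s $ i)"
      by (rule sum.mono_neutral_right) (use assms in \<open>auto simp: n_def coeff_eq_0\<close>)
    ultimately show ?thesis using tele[of i n] by simp
  qed
  then show ?thesis by (simp add: vec_eq_iff x_def)
qed

lemma of_int_poly_eval_hom:
  fixes z :: "'a::comm_ring_1"
  shows "poly (map_poly of_int (p + q)) z = poly (map_poly of_int p) z + poly (map_poly of_int q) z"
    and "poly (map_poly of_int (p * q)) z = poly (map_poly of_int p) z * poly (map_poly of_int q) z"
proof -
  have "map_poly of_int (p + q) = map_poly of_int p + (map_poly of_int q :: 'a poly)"
    by (rule poly_eqI) (simp add: coeff_map_poly)
  then show "poly (map_poly of_int (p + q)) z = poly (map_poly of_int p) z + poly (map_poly of_int q) z"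
    by simp
  have "map_poly of_int (p * q) = map_poly of_int p * (map_poly of_int q :: 'a poly)"
    by (rule poly_eqI) (simp add: coeff_map_poly coeff_mult)
  then show "poly (map_poly of_int (p * q)) z = poly (map_poly of_int p) z * poly (map_poly of_int q) z"
    by simp
qed

lemma poly_charpoly:
  fixes z :: "'a::comm_ring_1" and M :: "int ^ 'd ^ 'd"
  shows "poly (map_poly of_int (charpoly M)) z = det (mat z - map_matrix of_int M)"
proof -
  let ?e = "\<lambda>p. poly (map_poly of_int p) z"
  have sum: "?e (sum f S) = (\<Sum>x\<in>S. ?e (f x))" if "finite S" for f and S :: "('d \<Rightarrow> 'd) set"
    using that by induction (simp_all add: of_int_poly_eval_hom)
  have prod: "?e (prod f S) = (\<Prod>x\<in>S. ?e (f x))" if "finite S" for f and S :: "'d set"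
    using that by induction (simp_all add: of_int_poly_eval_hom)
  have cst: "?e (of_int k) = of_int k" for k
    by (simp add: of_int_poly map_poly_pCons)
  have lin: "?e [: - M $ i $ j, if i = j then 1 else 0 :] = (mat z - map_matrix of_int M) $ i $ j" for i j
    by (simp add: map_poly_pCons mat_def)
  show ?thesis
    unfolding charpoly_def det_def
    by (simp add: sum finite_permutations of_int_poly_eval_hom prod cst lin del: poly_pCons cong: if_cong)
qed

lemma charpoly_root_iff_eigenvalue:
  fixes z :: "'a::field" and M :: "int ^ 'd ^ 'd"
  shows "poly (map_poly of_int (charpoly M)) z = 0 \<longleftrightarrow>
    (\<exists>v. v \<noteq> 0 \<and> map_matrix of_int M *v v = z *s v)"
proof -
  let ?A = "mat z - map_matrix of_int M :: 'a ^ 'd ^ 'd"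
  have mz: "mat z *v v = z *s v" for v :: "'a ^ 'd"
    by (simp add: matrix_vector_mult_def mat_def vec_eq_iff if_distrib if_distribR cong: if_cong)
  have "det ?A = 0 \<longleftrightarrow> \<not> invertible ?A"
    by (simp add: invertible_det_nz)
  also have "\<dots> \<longleftrightarrow> (\<exists>v. v \<noteq> 0 \<and> ?A *v v = 0)"
    unfolding invertible_left_inverse matrix_left_invertible_ker by auto
  also have "\<dots> \<longleftrightarrow> (\<exists>v. v \<noteq> 0 \<and> map_matrix of_int M *v v = z *s v)"
    by (auto simp: matrix_vector_mult_diff_rdistrib mz)
  finally show ?thesis by (simp add: poly_charpoly)
qed

definition spectrum_ge :: "int ^ 'd ^ 'd \<Rightarrow> real \<Rightarrow> bool" where
  "spectrum_ge M R \<longleftrightarrow>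
     (\<forall>(c::complex) v. v \<noteq> 0 \<and> map_matrix of_int M *v v = c *s v \<longrightarrow> R \<le> norm c)"

text \<open>Eigenvalues are roots of one nonzero polynomial, so there are finitely many and their moduli are
  bounded away from \<open>1\<close>.\<close>

lemma expanding_spectrum_gap:
  fixes M :: "int ^ 'd ^ 'd"
  assumes "expanding M"
  obtains r where "r > 1" "spectrum_ge M r"
proof -
  define q :: "complex poly" where "q = map_poly of_int (charpoly M)"
  have root: "poly q c = 0 \<longleftrightarrow> (\<exists>v :: complex ^ 'd. v \<noteq> 0 \<and> map_matrix of_int M *v v = c *s v)" for c
    unfolding q_def by (rule charpoly_root_iff_eigenvalue)
  have big: "norm c > 1" if "poly q c = 0" for c
    using that assms unfolding root expanding_def by blast
  then have "poly q 0 \<noteq> 0" by fastforce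
  then have "q \<noteq> 0" by auto
  then have fin: "finite {c. poly q c = 0}" by (rule poly_roots_finite)
  define r where "r = Min (insert 2 (norm ` {c. poly q c = 0}))"
  show ?thesis
  proof
    show "r > 1" unfolding r_def using fin big by (subst Min_gr_iff) auto
    show "spectrum_ge M r"
      unfolding spectrum_ge_def
    proof (intro allI impI)
      fix c :: complex and v :: "complex ^ 'd"
      assume "v \<noteq> 0 \<and> map_matrix of_int M *v v = c *s v"
      then have "poly q c = 0" unfolding root by blast
      then show "r \<le> norm c" unfolding r_def using fin by (intro Min_le) auto
    qed
  qed
qed

lemma map_matrix_of_int_mult:
  "map_matrix of_int (A ** B) = (map_matrix of_int A ** map_matrix of_int B :: 'a::comm_ring_1 ^ 'd ^ 'd)"
  by (simp add: vec_eq_iff matrix_matrix_mult_def)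

text \<open>If \<open>M\<^sup>2 v = w\<^sup>2 v\<close>, then \<open>(M - w)(M + w) v = 0\<close>, so one of
  \<open>w\<close> and \<open>- w\<close> is an eigenvalue of \<open>M\<close>. Repeated squaring thus
  makes all eigenvalues large.\<close>

lemma spectrum_ge_square:
  assumes "spectrum_ge M R" "R \<ge> 0"
  shows "spectrum_ge (M ** M) (R\<^sup>2)"
  unfolding spectrum_ge_def
proof (intro allI impI, elim conjE)
  fix c :: complex and v :: "complex ^ 'a"
  let ?M = "map_matrix of_int M :: complex ^ 'a ^ 'a"
  assume v: "v \<noteq> 0" and eig: "map_matrix of_int (M ** M) *v v = c *s v"
  define w where "w = csqrt c"
  have w: "w * w = c" using power2_csqrt[of c] by (simp add: w_def power2_eq_square)
  have MM: "?M *v (?M *v v) = c *s v"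
    using eig by (simp add: map_matrix_of_int_mult matrix_vector_mul_assoc)
  have "R \<le> norm w"
  proof (cases "?M *v v + w *s v = 0")
    case True
    then have "?M *v v = (- w) *s v"
      by (simp add: eq_neg_iff_add_eq_0)
    then show ?thesis using assms(1) v unfolding spectrum_ge_def by (metis norm_minus_cancel)
  next
    case False
    have "?M *v (?M *v v + w *s v) = c *s v + w *s (?M *v v)"
      by (simp add: matrix_vector_right_distrib MM vector_scalar_commute)
    also have "\<dots> = w *s (?M *v v + w *s v)"
      by (simp add: vec_eq_iff algebra_simps w[symmetric])
    finally show ?thesis using assms(1) False unfolding spectrum_ge_def by blast
  qed
  then have "R * R \<le> norm w * norm w" using assms(2) by (intro mult_mono) auto
  then show "R\<^sup>2 \<le> norm c" by (simp add: w[symmetric] norm_mult power2_eq_square)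
qed

lemma spectrum_ge_iterated_square:
  assumes "spectrum_ge M r" "r \<ge> 0"
  shows "\<exists>M'. spectrum_ge M' (r ^ (2 ^ k)) \<and> (\<lambda>x. x v* M') = (\<lambda>x. x v* M) ^^ (2 ^ k)"
proof (induction k)
  case 0
  then show ?case using assms by (intro exI[of _ M]) auto
next
  case (Suc k)
  then obtain M' where M': "spectrum_ge M' (r ^ (2 ^ k))" "(\<lambda>x. x v* M') = (\<lambda>x. x v* M) ^^ (2 ^ k)"
    by blast
  have "(\<lambda>x. x v* (M' ** M')) = (\<lambda>x. x v* M') \<circ> (\<lambda>x. x v* M')"
    by (simp add: fun_eq_iff vector_matrix_mul_assoc)
  also have "\<dots> = (\<lambda>x. x v* M) ^^ (2 ^ Suc k)"
    unfolding M'(2) funpow_add[symmetric] by (simp add: mult_2)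
  finally show ?case
    using spectrum_ge_square[OF M'(1)] assms(2)
    by (intro exI[of _ "M' ** M'"]) (simp add: power_mult[symmetric] mult.commute)
qed

text \<open>Each linear factor \<open>X - z\<close> multiplies the sum of the moduli of the coefficients by at
  most \<open>1 + \<bar>z\<bar>\<close> and the modulus of the constant coefficient by exactly
  \<open>\<bar>z\<bar>\<close>; with large roots the constant coefficient is therefore almost the
  whole sum.\<close>

lemma sum_norm_coeff_le:
  fixes p :: "complex poly"
  assumes "p \<noteq> 0" "R > 0" "\<And>z. poly p z = 0 \<Longrightarrow> R \<le> norm z" "degree p \<le> K"
  shows "(\<Sum>s\<le>K. norm (coeff p s)) \<le> norm (coeff p 0) * (1 + 1 / R) ^ K"
  using assms(1,3,4)
proof (induction K arbitrary: p)
  case 0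
  then show ?case by simp
next
  case (Suc K)
  show ?case
  proof (cases "degree p = 0")
    case True
    have "(\<Sum>s\<le>Suc K. norm (coeff p s)) = (\<Sum>s\<in>{0}. norm (coeff p s))"
      by (rule sum.mono_neutral_right) (auto simp: True coeff_eq_0)
    also have "\<dots> \<le> norm (coeff p 0) * (1 + 1 / R) ^ Suc K"
      using one_le_power[of "1 + 1 / R" "Suc K"] assms(2)
      by (simp add: mult_le_cancel_left1 del: power_Suc)
    finally show ?thesis .
  next
    case False
    then obtain z where z: "poly p z = 0"
      using fundamental_theorem_of_algebra[of p] constant_degree[of p] by auto
    then obtain q where q: "p = [:- z, 1:] * q" by (auto simp: poly_eq_0_iff_dvd dvd_def)
    have "q \<noteq> 0" using Suc.prems(1) q by auto
    have Rz: "R \<le> norm z" using Suc.prems(2) z by blast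
    have "degree p = Suc (degree q)" unfolding q using \<open>q \<noteq> 0\<close> by (subst degree_mult_eq) auto
    then have dq: "degree q \<le> K" using Suc.prems(3) by simp
    have IH: "(\<Sum>s\<le>K. norm (coeff q s)) \<le> norm (coeff q 0) * (1 + 1 / R) ^ K"
      using Suc.IH[OF \<open>q \<noteq> 0\<close> _ dq] Suc.prems(2) q by auto
    have c: "coeff p s = coeff (pCons 0 q) s - z * coeff q s" for s
      unfolding q by simp
    have "(\<Sum>s\<le>Suc K. norm (coeff p s))
        \<le> (\<Sum>s\<le>Suc K. norm (coeff (pCons 0 q) s) + norm z * norm (coeff q s))"
      unfolding c by (intro sum_mono order_trans[OF norm_triangle_ineq4]) (simp add: norm_mult)
    also have "\<dots> = (\<Sum>s\<le>Suc K. norm (coeff (pCons 0 q) s)) + norm z * (\<Sum>s\<le>Suc K. norm (coeff q s))"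
      by (simp add: sum.distrib sum_distrib_left del: sum.atMost_Suc)
    also have "(\<Sum>s\<le>Suc K. norm (coeff (pCons 0 q) s)) = (\<Sum>s\<le>K. norm (coeff q s))"
      by (simp add: sum.atMost_Suc_shift del: sum.atMost_Suc)
    also have "(\<Sum>s\<le>Suc K. norm (coeff q s)) = (\<Sum>s\<le>K. norm (coeff q s))"
      using dq by (simp add: coeff_eq_0)
    also have "(\<Sum>s\<le>K. norm (coeff q s)) + norm z * (\<Sum>s\<le>K. norm (coeff q s))
        = (1 + norm z) * (\<Sum>s\<le>K. norm (coeff q s))"
      by (simp add: algebra_simps)
    also have "\<dots> \<le> (norm z * (1 + 1 / R)) * (norm (coeff q 0) * (1 + 1 / R) ^ K)"
    proof (rule mult_mono[OF _ IH])
      show "1 + norm z \<le> norm z * (1 + 1 / R)"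
        using Rz assms(2) by (simp add: field_simps)
    qed (use assms(2) in \<open>auto intro!: sum_nonneg\<close>)
    also have "\<dots> = norm (coeff p 0) * (1 + 1 / R) ^ Suc K"
      by (simp add: q norm_mult)
    finally show ?thesis .
  qed
qed

text \<open>The relation is the characteristic polynomial of a high power of \<open>M\<close>: its roots are so
  large that the constant coefficient dominates.\<close>

lemma expanding_dominated_relation:
  fixes M :: "int ^ 'd ^ 'd"
  assumes "expanding M"
  obtains a :: "nat \<Rightarrow> int" and N
  where "0 < N" "a 0 \<noteq> 0" "2 * (\<Sum>s=1..CARD('d). \<bar>a s\<bar>) \<le> \<bar>a 0\<bar>"
    and "\<And>m. (\<Sum>s\<le>CARD('d). a s *s ((\<lambda>x. x v* M) ^^ (N * s)) m) = 0"
proof -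
  let ?d = "CARD('d)"
  obtain r where r: "r > 1" "spectrum_ge M r" using expanding_spectrum_gap[OF assms] .
  have "(\<lambda>k. 1 / r ^ k) \<longlonglongrightarrow> 0"
    using LIMSEQ_inverse_realpow_zero[OF r(1)] by (simp add: divide_inverse)
  then have "(\<lambda>k. (1 + 1 / r ^ k) ^ ?d) \<longlonglongrightarrow> (1 + 0) ^ ?d"
    by (intro tendsto_intros)
  \<comment> \<open>With this bound the coefficients other than the constant one sum to at most half of its modulus.\<close>
  then have "eventually (\<lambda>k. (1 + 1 / r ^ k) ^ ?d < 3 / 2) sequentially"
    by (intro order_tendstoD(2)) auto
  then obtain k0 where k0: "\<And>k. k \<ge> k0 \<Longrightarrow> (1 + 1 / r ^ k) ^ ?d < 3 / 2"
    by (auto simp: eventually_sequentially)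
  define N :: nat where "N = 2 ^ k0"
  have N: "(1 + 1 / r ^ N) ^ ?d < 3 / 2"
    by (rule k0) (simp add: N_def less_imp_le[OF less_exp])
  obtain M' where M': "spectrum_ge M' (r ^ N)" "(\<lambda>x. x v* M') = (\<lambda>x. x v* M) ^^ N"
    using spectrum_ge_iterated_square[OF r(2), of k0] r(1) unfolding N_def by auto
  define a where "a = coeff (charpoly M')"
  define q :: "complex poly" where "q = map_poly of_int (charpoly M')"
  have cq: "coeff q s = of_int (a s)" for s by (simp add: q_def a_def coeff_map_poly)
  have rN: "r ^ N > 0" using r by simp
  have roots: "r ^ N \<le> norm z" if "poly q z = 0" for z
    using that M'(1) unfolding q_def charpoly_root_iff_eigenvalue spectrum_ge_def by blast
  have "poly q 0 \<noteq> 0" using roots[of 0] rN by auto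
  then have "q \<noteq> 0" by auto
  have a0: "a 0 \<noteq> 0" using \<open>poly q 0 \<noteq> 0\<close> by (simp add: poly_0_coeff_0 cq)
  have "degree q \<le> ?d"
    using degree_charpoly[of M'] by (simp add: q_def degree_map_poly)
  from sum_norm_coeff_le[OF \<open>q \<noteq> 0\<close> rN roots this]
  have "(\<Sum>s\<le>?d. real_of_int \<bar>a s\<bar>) \<le> \<bar>a 0\<bar> * (1 + 1 / r ^ N) ^ ?d"
    by (simp add: cq)
  also have "\<dots> \<le> \<bar>a 0\<bar> * (3 / 2)"
    using N by (intro mult_left_mono) auto
  finally have *: "(\<Sum>s\<le>?d. real_of_int \<bar>a s\<bar>) \<le> \<bar>a 0\<bar> * (3 / 2)" .
  have "(\<Sum>s\<le>?d. \<bar>a s\<bar>) = \<bar>a 0\<bar> + (\<Sum>s=1..?d. \<bar>a s\<bar>)"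
    by (simp add: atMost_atLeast0 sum.atLeast_Suc_atMost)
  with * have "2 * real_of_int (\<Sum>s=1..?d. \<bar>a s\<bar>) \<le> \<bar>a 0\<bar>"
    unfolding of_int_sum[symmetric] by simp
  then have dom: "2 * (\<Sum>s=1..?d. \<bar>a s\<bar>) \<le> \<bar>a 0\<bar>" by linarith
  have "(\<Sum>s\<le>?d. a s *s ((\<lambda>x. x v* M) ^^ (N * s)) m) = 0" for m
    using cayley_hamilton[OF degree_charpoly, of M' m]
    unfolding M'(2) funpow_mult a_def by (simp add: mult.commute)
  moreover have "0 < N" by (simp add: N_def)
  ultimately show ?thesis using that a0 dom by blast
qed

lemma expanding_nonsingular:
  fixes M :: "int ^ 'd ^ 'd"
  assumes "expanding M" "x \<noteq> 0"
  shows "x v* M \<noteq> 0"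
proof
  assume x: "x v* M = 0"
  obtain a :: "nat \<Rightarrow> int" and N where N: "0 < N" and a0: "a 0 \<noteq> 0"
    and rel: "\<And>m. (\<Sum>s\<le>CARD('d). a s *s ((\<lambda>x. x v* M) ^^ (N * s)) m) = 0"
    by (rule expanding_dominated_relation[OF assms(1)]) (rule that)
  have z: "((\<lambda>x. x v* M) ^^ k) x = 0" if "0 < k" for k
    using that by (induction k rule: nat_induct_non_zero) (simp_all add: x)
  have "(\<Sum>s\<le>CARD('d). a s *s ((\<lambda>x. x v* M) ^^ (N * s)) x) = a 0 *s x"
  proof -
    have "(\<Sum>s\<le>CARD('d). a s *s ((\<lambda>x. x v* M) ^^ (N * s)) x) =
        (\<Sum>s\<in>{0}. a s *s ((\<lambda>x. x v* M) ^^ (N * s)) x)"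
      by (rule sum.mono_neutral_right) (use N in \<open>auto simp: z\<close>)
    then show ?thesis by simp
  qed
  with rel[of x] have "a 0 *s x = 0" by simp
  with a0 assms(2) show False by (simp add: vec_eq_iff)
qed

section \<open>Distance to the integers along orbits of expanding matrices\<close>

text \<open>The signed deviation of a real number from a nearest integer. It is used in place of the distance to
  the integers because integer linear relations pass to it modulo \<open>1\<close>.\<close>

definition nint_dev :: "real \<Rightarrow> real" where
  "nint_dev t = t - of_int (round t)"

lemma nint_dev_le_half: "\<bar>nint_dev t\<bar> \<le> 1 / 2"
  using of_int_round_abs_le[of t] by (simp add: nint_dev_def abs_minus_commute)

lemma nint_dev_Ints: "t - nint_dev t \<in> \<int>"
  by (simp add: nint_dev_def)

lemma nint_dev_eq_0D: "nint_dev t = 0 \<Longrightarrow> t \<in> \<int>"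
  using nint_dev_Ints[of t] by simp

definition pairing :: "int ^ 'd \<Rightarrow> real ^ 'd \<Rightarrow> real" where
  "pairing m x = (\<Sum>i\<in>UNIV. of_int (m $ i) * x $ i)"

lemma pairing_add_right: "pairing m (x + y) = pairing m x + pairing m y"
  by (simp add: pairing_def algebra_simps sum.distrib)

lemma pairing_diff_right: "pairing m (x - y) = pairing m x - pairing m y"
  by (simp add: pairing_def algebra_simps sum_subtractf)

lemma pairing_zero_left [simp]: "pairing 0 x = 0"
  by (simp add: pairing_def)

lemma pairing_add_left: "pairing (m + m') x = pairing m x + pairing m' x"
  by (simp add: pairing_def algebra_simps sum.distrib)

lemma pairing_smult_left: "pairing (k *s m) x = of_int k * pairing m x"
  by (simp add: pairing_def algebra_simps sum_distrib_left)

lemma pairing_sum_left: "pairing (\<Sum>s\<in>S. f s) x = (\<Sum>s\<in>S. pairing (f s) x)"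
  by (induction S rule: infinite_finite_induct) (simp_all add: pairing_add_left)

lemma pairing_matrix: "pairing m (map_matrix of_int M *v x) = pairing (m v* M) x"
  unfolding pairing_def matrix_vector_mult_def vector_matrix_mult_def
  by (simp add: sum_distrib_left sum_distrib_right mult_ac) (rule sum.swap)

text \<open>The quantitative form of expansion: if the first \<open>L\<close> deviations along the orbit are
  below \<open>\<epsilon>\<close>, then the initial one is at most half of any common bound
  \<open>U\<close> for them.\<close>

definition contracts_dev :: "int ^ 'd ^ 'd \<Rightarrow> nat \<Rightarrow> real \<Rightarrow> bool" where
  "contracts_dev M L \<epsilon> \<longleftrightarrow> (\<forall>m c U.
     (\<forall>s<L. \<bar>nint_dev (pairing (((\<lambda>x. x v* M) ^^ s) m) c)\<bar> < \<epsilon> \<and>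
            \<bar>nint_dev (pairing (((\<lambda>x. x v* M) ^^ s) m) c)\<bar> \<le> U) \<longrightarrow>
     \<bar>nint_dev (pairing m c)\<bar> \<le> U / 2)"

text \<open>The dominated relation holds for the real numbers \<open>y s\<close>, hence for their deviations up
  to an integer. When the deviations are small, this integer has modulus less than \<open>1\<close>
  and is zero, and domination by the constant coefficient bounds the first deviation.\<close>

lemma expanding_contracts_dev:
  fixes M :: "int ^ 'd ^ 'd"
  assumes "expanding M"
  shows "\<exists>L \<epsilon>. 0 < L \<and> 0 < \<epsilon> \<and> contracts_dev M L \<epsilon>"
proof -
  let ?d = "CARD('d)"
  obtain a :: "nat \<Rightarrow> int" and N where a0: "a 0 \<noteq> 0" and dom: "2 * (\<Sum>s=1..?d. \<bar>a s\<bar>) \<le> \<bar>a 0\<bar>"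
    and rel: "\<And>m. (\<Sum>s\<le>?d. a s *s ((\<lambda>x. x v* M) ^^ (N * s)) m) = 0"
    by (rule expanding_dominated_relation[OF assms]) (rule that)
  define T where "T = (\<Sum>s\<le>?d. \<bar>real_of_int (a s)\<bar>)"
  have T: "T \<ge> 0" by (simp add: T_def sum_nonneg)
  define L where "L = Suc (N * ?d)"
  define \<epsilon> where "\<epsilon> = 1 / (T + 1)"
  have main: "\<bar>nint_dev (pairing m c)\<bar> \<le> U / 2"
    if H: "\<forall>s<L. \<bar>nint_dev (pairing (((\<lambda>x. x v* M) ^^ s) m) c)\<bar> < \<epsilon> \<and>
                  \<bar>nint_dev (pairing (((\<lambda>x. x v* M) ^^ s) m) c)\<bar> \<le> U" for m c U
  proof -
    define y where "y s = pairing (((\<lambda>x. x v* M) ^^ (N * s)) m) c" for s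
    have small: "\<bar>nint_dev (y s)\<bar> < \<epsilon>" "\<bar>nint_dev (y s)\<bar> \<le> U" if "s \<le> ?d" for s
    proof -
      have "N * s < L" using that by (simp add: L_def less_Suc_eq_le)
      then show "\<bar>nint_dev (y s)\<bar> < \<epsilon>" "\<bar>nint_dev (y s)\<bar> \<le> U" using H unfolding y_def by auto
    qed
    have U: "U \<ge> 0" using small(2)[of 0] by linarith
    have zero: "(\<Sum>s\<le>?d. a s * y s) = 0"
      using arg_cong[OF rel[of m], of "\<lambda>v. pairing v c"]
      by (simp add: pairing_sum_left pairing_smult_left y_def)
    have "(\<Sum>s\<le>?d. a s * nint_dev (y s)) = - (\<Sum>s\<le>?d. a s * (y s - nint_dev (y s)))"
      using zero by (simp add: right_diff_distrib sum_subtractf)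
    also have "\<dots> \<in> \<int>"
      by (intro Ints_minus Ints_sum Ints_mult nint_dev_Ints) auto
    finally have int: "(\<Sum>s\<le>?d. a s * nint_dev (y s)) \<in> \<int>" .
    have "\<bar>\<Sum>s\<le>?d. a s * nint_dev (y s)\<bar> \<le> (\<Sum>s\<le>?d. \<bar>real_of_int (a s)\<bar> * \<epsilon>)"
      by (rule order_trans[OF sum_abs])
        (auto intro!: sum_mono mult_left_mono less_imp_le[OF small(1)] simp: abs_mult)
    also have "\<dots> = T * \<epsilon>" by (simp add: T_def sum_distrib_right)
    also have "\<dots> < 1" using T by (simp add: \<epsilon>_def)
    finally have "(\<Sum>s\<le>?d. a s * nint_dev (y s)) = 0"
      using int Ints_nonzero_abs_less1 by blast
    moreover have "(\<Sum>s\<le>?d. a s * nint_dev (y s)) = a 0 * nint_dev (y 0) + (\<Sum>s=1..?d. a s * nint_dev (y s))"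
      by (simp add: atMost_atLeast0 sum.atLeast_Suc_atMost)
    ultimately have "\<bar>a 0 * nint_dev (y 0)\<bar> = \<bar>\<Sum>s=1..?d. a s * nint_dev (y s)\<bar>"
      by linarith
    also have "\<dots> \<le> (\<Sum>s=1..?d. \<bar>real_of_int (a s)\<bar> * U)"
      by (rule order_trans[OF sum_abs]) (auto intro!: sum_mono mult_left_mono small(2) simp: abs_mult)
    also have "\<dots> = of_int (\<Sum>s=1..?d. \<bar>a s\<bar>) * U" by (simp add: sum_distrib_right)
    also have "\<dots> \<le> (\<bar>real_of_int (a 0)\<bar> / 2) * U"
      using dom U by (intro mult_right_mono) linarith+
    finally have "\<bar>real_of_int (a 0)\<bar> * \<bar>nint_dev (y 0)\<bar> \<le> \<bar>real_of_int (a 0)\<bar> * (U / 2)"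
      by (simp add: abs_mult)
    then have "\<bar>nint_dev (y 0)\<bar> \<le> U / 2"
      using a0 by (subst (asm) mult_le_cancel_left_pos) auto
    then show ?thesis by (simp add: y_def)
  qed
  show ?thesis
  proof (intro exI conjI)
    show "0 < L" "0 < \<epsilon>" using T by (auto simp: L_def \<epsilon>_def)
    show "contracts_dev M L \<epsilon>" unfolding contracts_dev_def using main by blast
  qed
qed

lemma contracts_dev_mono:
  assumes "contracts_dev M L \<epsilon>" "L \<le> L'" "\<epsilon>' \<le> \<epsilon>"
  shows "contracts_dev M L' \<epsilon>'"
  unfolding contracts_dev_def
proof (intro allI impI)
  fix m c U
  assume *: "\<forall>s<L'. \<bar>nint_dev (pairing (((\<lambda>x. x v* M) ^^ s) m) c)\<bar> < \<epsilon>' \<and>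
            \<bar>nint_dev (pairing (((\<lambda>x. x v* M) ^^ s) m) c)\<bar> \<le> U"
  have "\<forall>s<L. \<bar>nint_dev (pairing (((\<lambda>x. x v* M) ^^ s) m) c)\<bar> < \<epsilon> \<and>
            \<bar>nint_dev (pairing (((\<lambda>x. x v* M) ^^ s) m) c)\<bar> \<le> U"
  proof (intro allI impI)
    fix s assume "s < L"
    with assms(2) have "s < L'" by simp
    with * assms(3) show "\<bar>nint_dev (pairing (((\<lambda>x. x v* M) ^^ s) m) c)\<bar> < \<epsilon> \<and>
            \<bar>nint_dev (pairing (((\<lambda>x. x v* M) ^^ s) m) c)\<bar> \<le> U" by fastforce
  qed
  with assms(1) show "\<bar>nint_dev (pairing m c)\<bar> \<le> U / 2"
    unfolding contracts_dev_def by blast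
qed

lemma uniform_contracts_dev:
  assumes "finite I" "\<And>i. i \<in> I \<Longrightarrow> expanding (M i)"
  shows "\<exists>L \<epsilon>. 0 < L \<and> 0 < \<epsilon> \<and> (\<forall>i\<in>I. contracts_dev (M i) L \<epsilon>)"
  using assms
proof (induction I)
  case empty
  then show ?case by (intro exI[of _ 1]) auto
next
  case (insert j I)
  have "\<And>i. i \<in> I \<Longrightarrow> expanding (M i)" by (rule insert.prems) simp
  from insert.IH[OF this] obtain L \<epsilon>
    where 1: "0 < L" "0 < \<epsilon>" "\<forall>i\<in>I. contracts_dev (M i) L \<epsilon>"
    by blast
  obtain L' \<epsilon>' where 2: "0 < L'" "0 < \<epsilon>'" "contracts_dev (M j) L' \<epsilon>'"
    using expanding_contracts_dev[OF insert.prems, of j] by blast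
  have "\<forall>i\<in>insert j I. contracts_dev (M i) (max L L') (min \<epsilon> \<epsilon>')"
    using 1(3) 2(3) by (auto intro: contracts_dev_mono)
  with 1 2 show ?case
    by (intro exI[of _ "max L L'"] exI[of _ "min \<epsilon> \<epsilon>'"]) auto
qed

text \<open>The words of a box: as the matrices commute, a word stands for the vector of its letter counts, and
  these counts range over a cube of side \<open>L\<close>.\<close>

definition short_words :: "'i set \<Rightarrow> nat \<Rightarrow> 'i list set" where
  "short_words I L = {w. set w \<subseteq> I \<and> (\<forall>i. count_list w i < L)}"

lemma length_short_words:
  assumes "finite I" "w \<in> short_words I L"
  shows "length w \<le> card I * L"
proof -
  have "length w = (\<Sum>i\<in>set w. count_list w i)"
    by (simp add: sum_count_set)
  also have "\<dots> \<le> (\<Sum>i\<in>set w. L)"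
    using assms(2) by (intro sum_mono) (auto simp: short_words_def less_imp_le)
  also have "\<dots> \<le> card I * L"
    using assms by (auto simp: short_words_def intro!: card_mono)
  finally show ?thesis .
qed

text \<open>Let \<open>U\<close> be the supremum of \<open>\<bar>g\<bar>\<close> over all points reached from
  the path by short words. Such a point \<open>w\<close> over \<open>path t\<close> is also reached
  from \<open>path (Suc t)\<close> by a shorter word as long as \<open>w\<close> contains the letter
  \<open>i t\<close> of the next step. Once it does not, the word can be prolonged by up to \<open>L -
  1\<close> copies of that letter without leaving the box, and contraction bounds
  \<open>\<bar>g\<bar>\<close> by \<open>U / 2\<close>. So \<open>U \<le> U / 2\<close>. Contraction
  along each single letter is enough for this, whichever letters the path uses.\<close>

lemma small_along_path_imp_zero:
  fixes A :: "'i \<Rightarrow> 'm \<Rightarrow> 'm" and g :: "'m \<Rightarrow> real" and path :: "nat \<Rightarrow> 'm"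
  assumes comm: "\<And>i j. i \<in> I \<Longrightarrow> j \<in> I \<Longrightarrow> A i \<circ> A j = A j \<circ> A i"
    and L: "0 < L"
    and contr: "\<And>i m U. i \<in> I \<Longrightarrow> (\<forall>s<L. \<bar>g ((A i ^^ s) m)\<bar> < \<epsilon> \<and> \<bar>g ((A i ^^ s) m)\<bar> \<le> U) \<Longrightarrow>
           \<bar>g m\<bar> \<le> U / 2"
    and path: "\<And>t. i t \<in> I" "\<And>t. path (Suc t) = A (i t) (path t)"
    and small: "\<And>t w. w \<in> short_words I L \<Longrightarrow> \<bar>g (fold A w (path t))\<bar> < \<epsilon>"
  shows "g (path t) = 0"
proof -
  define X where "X = {\<bar>g (fold A w (path t))\<bar> | w t. w \<in> short_words I L}"
  define U where "U = Sup X"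
  have bdd: "bdd_above X"
    by (rule bdd_aboveI[of _ \<epsilon>]) (auto simp: X_def dest: small[THEN less_imp_le])
  have le_U: "\<bar>g (fold A w (path t))\<bar> \<le> U" if "w \<in> short_words I L" for w t
    unfolding U_def by (rule cSup_upper[OF _ bdd]) (use that in \<open>auto simp: X_def\<close>)
  have nil: "[] \<in> short_words I L" using L by (auto simp: short_words_def)
  have half: "\<bar>g (fold A w (path t))\<bar> \<le> U / 2" if "w \<in> short_words I L" for w t
    using that
  proof (induction "length w" arbitrary: w t rule: less_induct)
    case less
    have w: "set w \<subseteq> I" "\<And>j. count_list w j < L" using less.prems by (auto simp: short_words_def)
    show ?case
    proof (cases "i t \<in> set w")
      case True
      have "fold A w (path t) = fold A (remove1 (i t) w) (path (Suc t))"
      proof -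
        have "fold A w = fold A (remove1 (i t) w) \<circ> A (i t)"
          by (rule fold_remove1_split[OF comm True]) (use w(1) in auto)
        then show ?thesis by (simp add: path(2))
      qed
      moreover have "remove1 (i t) w \<in> short_words I L"
      proof -
        have "count_list (remove1 (i t) w) j \<le> count_list w j" for j
          by (induction w) auto
        then have "count_list (remove1 (i t) w) j < L" for j
          using w(2)[of j] le_less_trans by blast
        then show ?thesis using w set_remove1_subset[of "i t" w]
          unfolding short_words_def by blast
      qed
      moreover have "length (remove1 (i t) w) < length w"
        using length_pos_if_in_set[OF True] True by (simp add: length_remove1)
      ultimately show ?thesis using less.hyps by metis
    next
      case False
      show ?thesis
      proof (rule contr[OF path(1)[of t]], intro allI impI)
        fix s assume s: "s < L"
        have "(A (i t) ^^ s) (fold A w (path t)) = fold A (w @ replicate s (i t)) (path t)"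
          by (induction s) (auto simp: replicate_append_same[symmetric] simp del: replicate_append_same)
        moreover have "w @ replicate s (i t) \<in> short_words I L"
        proof -
          have "count_list (replicate s (i t)) j = (if j = i t then s else 0)" for j
            by (induction s) auto
          then show ?thesis using w False s path(1)[of t]
            by (auto simp: short_words_def)
        qed
        ultimately show "\<bar>g ((A (i t) ^^ s) (fold A w (path t)))\<bar> < \<epsilon> \<and>
            \<bar>g ((A (i t) ^^ s) (fold A w (path t)))\<bar> \<le> U"
          using small le_U by metis
      qed
    qed
  qed
  have "U \<le> U / 2"
    by (subst (1) U_def, rule cSup_least) (use nil half in \<open>auto simp: X_def\<close>)
  then have "\<bar>g (path t)\<bar> \<le> 0" using le_U[OF nil, of t] by simp
  then show ?thesis by simp
qed

section \<open>A maximum principle on the dual group\<close>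

text \<open>The quantitative maximum principle: if a weighted mean is within \<open>\<delta>\<close> of an upper
  bound \<open>S\<close> of the terms, each term is within \<open>\<delta>\<close> divided by its
  weight.\<close>

lemma average_close_to_max:
  fixes p w :: "'i \<Rightarrow> real"
  assumes fin: "finite I" and p: "\<And>i. i \<in> I \<Longrightarrow> 0 \<le> p i" "sum p I = 1"
    and w: "\<And>i. i \<in> I \<Longrightarrow> w i \<le> S" and avg: "S - \<delta> \<le> (\<Sum>i\<in>I. p i * w i)" and j: "j \<in> I"
  shows "p j * (S - w j) \<le> \<delta>"
proof -
  have "p j * (S - w j) \<le> (\<Sum>i\<in>I. p i * (S - w i))"
    using p w j fin by (intro member_le_sum) auto
  also have "\<dots> = S - (\<Sum>i\<in>I. p i * w i)"
    by (simp add: right_diff_distrib sum_subtractf p(2) flip: sum_distrib_right)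
  finally show ?thesis using avg by linarith
qed

lemma norm_one_plus_cis: "norm (1 + cis (2 * pi * t)) = 2 * cos (pi * nint_dev t)"
proof -
  have c: "cis (2 * pi * t) = cis (pi * nint_dev t) * cis (pi * nint_dev t)"
  proof -
    have "cis (2 * pi * t) = cis (2 * pi * nint_dev t) * cis (2 * pi * of_int (round t))"
      unfolding cis_mult nint_dev_def by (simp add: algebra_simps)
    also have "cis (2 * pi * of_int (round t)) = 1"
      by (rule cis_multiple_2pi) simp
    finally show ?thesis by (simp add: cis_mult mult.assoc)
  qed
  have "1 + cis (2 * pi * t) = cis (pi * nint_dev t) * (cis (- (pi * nint_dev t)) + cis (pi * nint_dev t))"
    unfolding c by (simp add: distrib_left cis_mult)
  also have "cis (- (pi * nint_dev t)) + cis (pi * nint_dev t) = of_real (2 * cos (pi * nint_dev t))"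
    by (simp add: complex_eq_iff)
  finally have "norm (1 + cis (2 * pi * t)) = \<bar>2 * cos (pi * nint_dev t)\<bar>"
    by (simp only: norm_mult norm_cis norm_of_real mult_1)
  moreover have "\<bar>pi * nint_dev t\<bar> \<le> pi * (1 / 2)"
    unfolding abs_mult using nint_dev_le_half[of t] by (intro mult_mono) auto
  then have "cos (pi * nint_dev t) \<ge> 0"
    by (intro cos_ge_zero) linarith+
  ultimately show ?thesis by simp
qed

lemma nint_dev_less_of_norm_one_plus_cis:
  assumes "0 < \<epsilon>" "\<epsilon> \<le> 1 / 2" "cos (pi * \<epsilon>) < norm (1 + cis (2 * pi * t)) / 2"
  shows "\<bar>nint_dev t\<bar> < \<epsilon>"
proof (rule ccontr)
  assume "\<not> \<bar>nint_dev t\<bar> < \<epsilon>"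
  then have "cos (pi * \<bar>nint_dev t\<bar>) \<le> cos (pi * \<epsilon>)"
    using assms(1) nint_dev_le_half[of t] by (subst cos_mono_le_eq) (auto simp: mult_le_cancel_left1 intro: order_trans)
  moreover have "cos (pi * \<bar>nint_dev t\<bar>) = cos (pi * nint_dev t)"
    by (simp add: abs_if)
  ultimately show False using assms(3) by (simp add: norm_one_plus_cis)
qed

text \<open>If \<open>F\<close> had a positive supremum \<open>S\<close> off the origin, then near a point where
  \<open>F\<close> almost attains \<open>S\<close>, inequality \<open>sub1\<close> would carry
  near-maximality along short words and \<open>sub2\<close> would force the phases there to be almost
  trivial. Following a path on which \<open>F\<close> does not decrease, the previous section makes
  all phases exactly trivial at its origin.\<close>

lemma vanishing_of_twisted_subharmonic:
  fixes D :: "nat \<Rightarrow> int ^ 'd ^ 'd" and p :: "nat \<Rightarrow> real" and c :: "nat \<Rightarrow> nat \<Rightarrow> real ^ 'd"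
    and F :: "int ^ 'd \<Rightarrow> real"
  assumes I: "finite I"
    and comm: "\<And>i j. i \<in> I \<Longrightarrow> j \<in> I \<Longrightarrow> D i ** D j = D j ** D i"
    and expanding: "\<And>i. i \<in> I \<Longrightarrow> expanding (D i)"
    and p: "\<And>i. i \<in> I \<Longrightarrow> 0 < p i" "sum p I = 1"
    and F: "\<And>m. 0 \<le> F m" "\<And>m. F m \<le> 1"
    and sub1: "\<And>m. F m \<le> (\<Sum>i\<in>I. p i * F (m v* D i))"
    and sub2: "\<And>m. F m \<le> (\<Sum>(i, j)\<in>I \<times> I. (p i * p j) *
          (norm (1 + cis (2 * pi * pairing m (c i j))) / 2 * F (m v* D i v* D j)))"
    and separating: "\<And>m. m \<noteq> 0 \<Longrightarrow> \<exists>i\<in>I. \<exists>j\<in>I. pairing m (c i j) \<notin> \<int>"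
    and m: "m \<noteq> 0"
  shows "F m = 0"
proof (rule ccontr)
  assume "F m \<noteq> 0"
  with F(1)[of m] have Fm: "F m > 0" by simp
  let ?A = "\<lambda>i m. m v* D i"
  have inj: "x v* D i \<noteq> 0" if "i \<in> I" "x \<noteq> 0" for i x
    using expanding_nonsingular[OF expanding[OF that(1)] that(2)] .
  have inj_fold: "fold ?A w x \<noteq> 0" if "set w \<subseteq> I" "x \<noteq> 0" for w x
    using that by (induction w arbitrary: x) (auto simp: inj)
  define S where "S = (SUP m\<in>-{0}. F m)"
  have bdd: "bdd_above (F ` (-{0}))" by (rule bdd_aboveI[of _ 1]) (use F in auto)
  have S: "F x \<le> S" if "x \<noteq> 0" for x unfolding S_def by (rule cSUP_upper[OF _ bdd]) (use that in auto)
  have "S > 0" using S[OF m] Fm by linarith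
  obtain L \<epsilon>' where L: "0 < L" and "0 < \<epsilon>'" and con': "\<forall>i\<in>I. contracts_dev (D i) L \<epsilon>'"
    using uniform_contracts_dev[of I D] I expanding by blast
  define \<epsilon> where "\<epsilon> = min \<epsilon>' (1 / 2)"
  have eps: "0 < \<epsilon>" "\<epsilon> \<le> 1 / 2" using \<open>0 < \<epsilon>'\<close> by (auto simp: \<epsilon>_def)
  have con: "contracts_dev (D i) L \<epsilon>" if "i \<in> I" for i
    using contracts_dev_mono[of "D i" L \<epsilon>' L \<epsilon>] con' that by (auto simp: \<epsilon>_def)
  have "I \<noteq> {}" using p(2) by auto
  define q where "q = Min (p ` I)"
  have q: "0 < q" "\<And>i. i \<in> I \<Longrightarrow> q \<le> p i"
    unfolding q_def using I \<open>I \<noteq> {}\<close> p by (auto simp: Min_gr_iff)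
  have q1: "q \<le> 1"
  proof -
    obtain i where i: "i \<in> I" using \<open>I \<noteq> {}\<close> by blast
    have "p i \<le> sum p I" using p I i by (intro member_le_sum) (auto intro: less_imp_le)
    then show ?thesis using q(2)[OF i] p(2) by linarith
  qed
  define \<gamma> where "\<gamma> = 1 - cos (pi * \<epsilon>)"
  have g: "\<gamma> > 0"
    unfolding \<gamma>_def using cos_monotone_0_pi[of 0 "pi * \<epsilon>"] eps by (auto simp: mult_le_cancel_left1)
  define K where "K = card I * L"
  \<comment> \<open>The defect allowed at the start: it may be divided by \<open>q\<close> for each of at most
    \<open>K\<close> letters of a short word and for the two letters in \<open>sub2\<close>, and must
    then still be less than \<open>S * \<gamma>\<close>.\<close>
  define \<delta> where "\<delta> = S * (\<gamma> * q ^ (K + 2) / 2)"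
  have d: "\<delta> > 0" using \<open>S > 0\<close> g q(1) by (simp add: \<delta>_def)
  \<comment> \<open>Near-maximality passes to every successor, with a loss factor \<open>1 / q\<close>.\<close>
  have step: "S - \<eta> / q \<le> F (x v* D i)" if "i \<in> I" "x \<noteq> 0" "S - \<eta> \<le> F x" for i x \<eta>
  proof -
    have "p i * (S - F (x v* D i)) \<le> \<eta>"
    proof (rule average_close_to_max[where p = p and w = "\<lambda>i. F (x v* D i)", OF I _ p(2) _ _ that(1)])
      show "S - \<eta> \<le> (\<Sum>i\<in>I. p i * F (x v* D i))" using that(3) sub1[of x] by linarith
    qed (use p that(2) S inj in \<open>auto intro: less_imp_le\<close>)
    moreover have "q * (S - F (x v* D i)) \<le> p i * (S - F (x v* D i))"
      using q(2) S inj that by (intro mult_right_mono) auto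
    ultimately show ?thesis using q(1) by (simp add: field_simps)
  qed
  have words: "S - \<eta> / q ^ length w \<le> F (fold ?A w x)" if "set w \<subseteq> I" "x \<noteq> 0" "S - \<eta> \<le> F x" for w x \<eta>
    using that
  proof (induction w arbitrary: x \<eta>)
    case (Cons i w)
    then show ?case
      using Cons.IH[of "x v* D i" "\<eta> / q"] step[of i x \<eta>] inj by (simp add: mult.commute)
  qed simp
  have phase: "\<bar>nint_dev (pairing (fold ?A w x) (c i j))\<bar> < \<epsilon>"
    if w: "w \<in> short_words I L" and x: "x \<noteq> 0" "S - \<delta> \<le> F x" and ij: "i \<in> I" "j \<in> I" for w x i j
  proof -
    define y where "y = fold ?A w x"
    have wI: "set w \<subseteq> I" using w by (auto simp: short_words_def)
    have y0: "y \<noteq> 0" unfolding y_def by (rule inj_fold[OF wI x(1)])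
    define P where "P = norm (1 + cis (2 * pi * pairing y (c i j))) / 2"
    have le1: "norm (1 + cis t) / 2 \<le> 1" for t
      using norm_triangle_ineq[of 1 "cis t"] by simp
    have len: "length w \<le> K" unfolding K_def by (rule length_short_words[OF I w])
    have "S - \<delta> / q ^ length w \<le> F y" unfolding y_def by (rule words[OF wI x])
    moreover have "\<delta> / q ^ length w \<le> \<delta> / q ^ K"
      using d q(1) q1 len by (intro divide_left_mono power_decreasing) auto
    ultimately have Fy: "S - \<delta> / q ^ K \<le> F y" by linarith
    have "p i * p j * (S - P * F (y v* D i v* D j)) \<le> \<delta> / q ^ K"
    proof -
      let ?w = "\<lambda>(i, j). norm (1 + cis (2 * pi * pairing y (c i j))) / 2 * F (y v* D i v* D j)"
      have "(case (i, j) of (i, j) \<Rightarrow> p i * p j) * (S - ?w (i, j)) \<le> \<delta> / q ^ K"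
      proof (rule average_close_to_max[where I = "I \<times> I"])
        show "finite (I \<times> I)" using I by simp
        show "(\<Sum>(i, j)\<in>I \<times> I. p i * p j) = 1"
          by (simp add: sum.cartesian_product[symmetric] sum_distrib_left[symmetric] p(2))
        show "S - \<delta> / q ^ K \<le> (\<Sum>z\<in>I \<times> I. (case z of (i, j) \<Rightarrow> p i * p j) * ?w z)"
          using Fy sub2[of y] by (simp add: case_prod_unfold)
        show "?w z \<le> S" if zI: "z \<in> I \<times> I" for z
        proof -
          obtain a b where z: "z = (a, b)" "a \<in> I" "b \<in> I" using zI by auto
          have "norm (1 + cis (2 * pi * pairing y (c a b))) / 2 * F (y v* D a v* D b) \<le> 1 * S"
            using z S inj y0 F le1 by (intro mult_mono) auto
          then show ?thesis by (simp add: z)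
        qed
      qed (use p ij in \<open>auto intro: mult_nonneg_nonneg less_imp_le\<close>)
      then show ?thesis by (simp add: P_def)
    qed
    moreover have "S * (1 - P) \<le> S - P * F (y v* D i v* D j)"
    proof -
      have "P * F (y v* D i v* D j) \<le> P * S"
        using S inj y0 ij by (intro mult_left_mono) (auto simp: P_def)
      then show ?thesis by (simp add: algebra_simps)
    qed
    moreover have "q * q * (S * (1 - P)) \<le> p i * p j * (S * (1 - P))"
      using q ij \<open>S > 0\<close> le1[of "2 * pi * pairing y (c i j)"]
      by (intro mult_right_mono mult_mono) (auto simp: P_def intro: less_imp_le[OF p(1)])
    moreover have "p i * p j * (S * (1 - P)) \<le> p i * p j * (S - P * F (y v* D i v* D j))"
      using calculation(2) p(1) ij by (intro mult_left_mono) (auto intro: less_imp_le)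
    ultimately have "q * q * (S * (1 - P)) \<le> \<delta> / q ^ K" by linarith
    also have "\<delta> / q ^ K = q * q * (S * (\<gamma> / 2))"
      using q(1) by (simp add: \<delta>_def power_add power2_eq_square)
    finally have "1 - P \<le> \<gamma> / 2" using q(1) \<open>S > 0\<close> by (simp add: mult_le_cancel_left_pos)
    then have "cos (pi * \<epsilon>) < P" using g by (simp add: \<gamma>_def)
    then show ?thesis
      using nint_dev_less_of_norm_one_plus_cis[OF eps] unfolding P_def y_def by blast
  qed
  obtain x0 where x0: "x0 \<noteq> 0" "S - \<delta> < F x0"
  proof -
    have "\<exists>x\<in>-{0}. S - \<delta> < F x"
      unfolding S_def[symmetric]
      using less_cSUP_iff[of "-{0}" F "S - \<delta>"] bdd m d unfolding S_def by auto
    then show ?thesis using that by auto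
  qed
  \<comment> \<open>Moving along this path costs nothing, so its length need not be controlled; only the short words
    attached to it use up the defect \<open>\<delta>\<close>.\<close>
  have greedy: "\<exists>i\<in>I. F x \<le> F (x v* D i)" for x
  proof (rule ccontr)
    assume "\<not> ?thesis"
    then have "(\<Sum>i\<in>I. p i * F (x v* D i)) < (\<Sum>i\<in>I. p i * F x)"
      using I \<open>I \<noteq> {}\<close> p by (intro sum_strict_mono) (auto intro!: mult_strict_left_mono)
    then show False using sub1[of x] by (simp add: p(2) flip: sum_distrib_right)
  qed
  then obtain nxt where nxt: "\<And>x. nxt x \<in> I" "\<And>x. F x \<le> F (x v* D (nxt x))" by metis
  define path where "path = rec_nat x0 (\<lambda>_ x. x v* D (nxt x))"
  have path: "path 0 = x0" "\<And>t. path (Suc t) = ?A (nxt (path t)) (path t)"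
    by (simp_all add: path_def)
  have good: "path t \<noteq> 0 \<and> S - \<delta> \<le> F (path t)" for t
  proof (induction t)
    case (Suc t)
    then show ?case using inj nxt[of "path t"] unfolding path(2) by (meson order_trans)
  qed (use x0 path in auto)
  have "nint_dev (pairing (path 0) (c i j)) = 0" if ij: "i \<in> I" "j \<in> I" for i j
  proof (rule small_along_path_imp_zero[where g = "\<lambda>m. nint_dev (pairing m (c i j))" and A = ?A
          and I = I and path = path and i = "\<lambda>t. nxt (path t)", OF _ L _ nxt(1) path(2)])
    show "?A a \<circ> ?A b = ?A b \<circ> ?A a" if "a \<in> I" "b \<in> I" for a b
      using comm[OF that] by (simp add: fun_eq_iff vector_matrix_mul_assoc)
    show "\<bar>nint_dev (pairing x (c i j))\<bar> \<le> U / 2"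
      if "a \<in> I" "\<forall>s<L. \<bar>nint_dev (pairing ((?A a ^^ s) x) (c i j))\<bar> < \<epsilon> \<and>
          \<bar>nint_dev (pairing ((?A a ^^ s) x) (c i j))\<bar> \<le> U" for a x U
      using con[OF that(1)] that(2) unfolding contracts_dev_def by blast
    show "\<bar>nint_dev (pairing (fold ?A w (path t)) (c i j))\<bar> < \<epsilon>" if "w \<in> short_words I L" for t w
      using phase[OF that _ _ ij] good by blast
  qed
  then have "pairing x0 (c i j) \<in> \<int>" if "i \<in> I" "j \<in> I" for i j
    using that nint_dev_eq_0D path(1) by metis
  with separating[OF x0(1)] show False by blast
qed

section \<open>Characters of the torus\<close>

lift_definition torus_char :: "int ^ 'd \<Rightarrow> 'd::finite torus \<Rightarrow> complex"
  is "\<lambda>m x. cis (2 * pi * pairing m x)"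
proof -
  fix m :: "int ^ 'd" and x y :: "real ^ 'd"
  assume "torus_rel x y"
  then have "pairing m (x - y) \<in> \<int>"
    unfolding torus_rel_def pairing_def by (intro Ints_sum Ints_mult) auto
  then have "cis (2 * pi * pairing m (x - y)) = 1" by (rule cis_multiple_2pi)
  moreover have "cis (2 * pi * pairing m x) = cis (2 * pi * pairing m (x - y)) * cis (2 * pi * pairing m y)"
    by (simp add: cis_mult pairing_diff_right right_diff_distrib)
  ultimately show "cis (2 * pi * pairing m x) = cis (2 * pi * pairing m y)" by simp
qed

lemma torus_char_to_torus: "torus_char m (to_torus x) = cis (2 * pi * pairing m x)"
  by (rule torus_char.abs_eq)

lemma norm_torus_char [simp]: "norm (torus_char m z) = 1"
  by (cases z rule: torus_cases) (simp add: torus_char_to_torus)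

lemma torus_char_zero_left [simp]: "torus_char 0 z = 1"
  by (cases z rule: torus_cases) (simp add: torus_char_to_torus)

lemma torus_char_add_right: "torus_char m (y + z) = torus_char m y * torus_char m z"
  by (cases y rule: torus_cases, cases z rule: torus_cases)
    (simp add: torus_char_to_torus pairing_add_right cis_mult distrib_left flip: to_torus_add)

lemma torus_char_add_left: "torus_char (m + m') z = torus_char m z * torus_char m' z"
  by (cases z rule: torus_cases)
    (simp add: torus_char_to_torus pairing_add_left cis_mult distrib_left)

lemma torus_char_uminus_left: "torus_char (- m) z = cnj (torus_char m z)"
proof -
  have "torus_char (- m) z * torus_char m z = 1" by (simp flip: torus_char_add_left)
  moreover have "cnj (torus_char m z) * torus_char m z = 1"
    using complex_norm_square[of "torus_char m z"] by (simp add: mult.commute)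
  moreover have "torus_char m z \<noteq> 0"
    using norm_torus_char[of m z] norm_zero zero_neq_one by metis
  ultimately show ?thesis using mult_right_cancel by metis
qed

lemma torus_char_toral_endo: "torus_char m (toral_endo D z) = torus_char (m v* D) z"
  by (cases z rule: torus_cases)
    (simp add: torus_char_to_torus toral_endo.abs_eq pairing_matrix)

lemma torus_char_zero_right [simp]: "torus_char m 0 = 1"
  by (simp add: zero_torus.abs_eq torus_char_to_torus pairing_def)

lemma continuous_on_torus_iff:
  "continuous_on UNIV f \<longleftrightarrow> continuous_on UNIV (\<lambda>x. f (to_torus x))"
  unfolding continuous_on_open_vimage[OF open_UNIV] open_torus_def by (simp add: vimage_def)

lemma continuous_on_torus_char: "continuous_on UNIV (torus_char m)"
  unfolding continuous_on_torus_iff torus_char_to_torus pairing_def by (intro continuous_intros)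

lemma continuous_on_torus_translate: "continuous_on UNIV ((+) (a :: 'd::finite torus))"
proof -
  obtain c where c: "a = to_torus c" by (rule torus_cases)
  have "continuous_on UNIV (\<lambda>x. to_torus (c + x))"
    by (intro continuous_on_compose2[OF continuous_on_to_torus] continuous_intros) auto
  then show ?thesis by (simp add: continuous_on_torus_iff c to_torus_add)
qed

lemma exists_torus_char_neq_one:
  fixes m :: "int ^ 'd"
  assumes "m \<noteq> 0"
  shows "\<exists>a. torus_char m a \<noteq> 1"
proof -
  obtain s where s: "m $ s \<noteq> 0" using assms by (auto simp: vec_eq_iff)
  define x :: "real ^ 'd" where "x = axis s (1 / (2 * of_int (m $ s)))"
  have "pairing m x = 1 / 2"
    using s by (simp add: x_def pairing_def axis_def if_distrib cong: if_cong)
  then have "2 * pi * pairing m x = pi" by simp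
  then have "torus_char m (to_torus x) = -1" by (simp only: torus_char_to_torus cis_pi)
  then show ?thesis by (intro exI[of _ "to_torus x"]) simp
qed

lemma integrable_haar_continuous:
  fixes f :: "'d::finite torus \<Rightarrow> 'b::{banach, second_countable_topology}"
  assumes "continuous_on UNIV f" "\<And>z. norm (f z) \<le> C"
  shows "integrable haar f"
proof -
  interpret prob_space "haar :: 'd torus measure" by (rule prob_space_haar)
  have "f \<in> borel_measurable borel" by (rule borel_measurable_continuous_onI[OF assms(1)])
  then have "f \<in> borel_measurable haar" by simp
  then show ?thesis by (intro integrable_const_bound[where B = C]) (auto simp: assms(2))
qed

text \<open>Translation by \<open>a\<close> multiplies the integral by \<open>e\<^sub>m(a)\<close> and leaves it
  unchanged.\<close>

lemma integral_haar_torus_char: "integral\<^sup>L haar (torus_char m) = (if m = 0 then 1 else 0)"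
proof (cases "m = 0")
  case True
  interpret prob_space "haar :: 'a torus measure" by (rule prob_space_haar)
  have "torus_char 0 = (\<lambda>z :: 'a torus. 1)" by auto
  then show ?thesis using True prob_space by simp
next
  case False
  obtain a where a: "torus_char m a \<noteq> 1" using exists_torus_char_neq_one[OF False] by blast
  have meas [measurable]: "(+) a \<in> measurable haar borel"
    using borel_measurable_continuous_onI[OF continuous_on_torus_translate[of a]] by simp
  have charm: "torus_char m \<in> borel_measurable borel"
    by (rule borel_measurable_continuous_onI[OF continuous_on_torus_char])
  have "distr haar borel ((+) a) = haar"
    by (rule measure_eqI) (auto simp: emeasure_distr[OF meas] haar_translation_invariant)
  then have "integral\<^sup>L haar (torus_char m) = integral\<^sup>L (distr haar borel ((+) a)) (torus_char m)" by simp
  also have "\<dots> = (\<integral>z. torus_char m (a + z) \<partial>haar)"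
    by (rule integral_distr[OF meas charm])
  also have "\<dots> = torus_char m a * integral\<^sup>L haar (torus_char m)"
    by (simp add: torus_char_add_right)
  finally show ?thesis using a False by auto
qed

inductive trig_poly :: "('d::finite torus \<Rightarrow> complex) \<Rightarrow> bool" where
  trig_char: "trig_poly (torus_char m)"
| trig_add: "trig_poly f \<Longrightarrow> trig_poly g \<Longrightarrow> trig_poly (\<lambda>z. f z + g z)"
| trig_scale: "trig_poly f \<Longrightarrow> trig_poly (\<lambda>z. c * f z)"

lemma trig_const: "trig_poly (\<lambda>z. c)"
  using trig_scale[OF trig_char[of 0], of c] by simp

lemma trig_mult:
  assumes "trig_poly f" "trig_poly g"
  shows "trig_poly (\<lambda>z. f z * g z)"
  using assms
proof (induction f)
  case (trig_char m)
  from trig_char show ?case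
  proof (induction g)
    case (trig_char m')
    then show ?case
      using trig_poly.trig_char[of "m + m'"] by (simp add: torus_char_add_left[abs_def])
  next
    case (trig_add f g)
    then show ?case using trig_poly.trig_add by (simp add: distrib_left)
  next
    case (trig_scale f c)
    then show ?case using trig_poly.trig_scale[of "\<lambda>z. torus_char m z * f z" c]
      by (simp add: mult.left_commute)
  qed
next
  case (trig_add f g')
  then show ?case using trig_poly.trig_add by (simp add: distrib_right)
next
  case (trig_scale f c)
  then show ?case using trig_poly.trig_scale[of "\<lambda>z. f z * g z" c] by (simp add: mult.assoc)
qed

lemma trig_sum: "(\<And>i. i \<in> S \<Longrightarrow> trig_poly (f i)) \<Longrightarrow> trig_poly (\<lambda>z. \<Sum>i\<in>S. f i z)"
  by (induction S rule: infinite_finite_induct) (auto intro: trig_const trig_add)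

text \<open>The embedding of the torus as a product of unit circles, used to transport the Stone-Weierstrass
  theorem from a compact subset of a Euclidean space.\<close>

definition torus_embed :: "'d::finite torus \<Rightarrow> complex ^ 'd" where
  "torus_embed z = (\<chi> i. torus_char (axis i 1) z)"

lemma pairing_axis: "pairing (axis i 1) x = x $ i"
  by (simp add: pairing_def axis_def if_distrib if_distribR cong: if_cong)

lemma inj_torus_embed: "inj torus_embed"
proof (rule injI)
  fix y z :: "'d::finite torus"
  assume eq: "torus_embed y = torus_embed z"
  obtain u v where uv: "y = to_torus u" "z = to_torus v" by (metis torus_cases)
  have "(u - v) $ i \<in> \<int>" for i
  proof -
    have "cis (2 * pi * u $ i) = cis (2 * pi * v $ i)"
      using arg_cong[OF eq, of "\<lambda>w. w $ i"]
      by (simp add: torus_embed_def uv torus_char_to_torus pairing_axis)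
    then obtain n :: int where "2 * pi * u $ i = 2 * pi * v $ i + 2 * pi * n"
      using sin_cos_eq_iff[of "2 * pi * u $ i" "2 * pi * v $ i"] by (auto simp: complex_eq_iff)
    then have "2 * pi * (u $ i - v $ i) = 2 * pi * n" by (simp add: algebra_simps)
    then show ?thesis by simp
  qed
  then show "y = z" by (simp add: uv to_torus_eq_iff)
qed

lemma continuous_on_torus_embed: "continuous_on UNIV (\<lambda>x. torus_embed (to_torus x))"
  unfolding torus_embed_def torus_char_to_torus pairing_axis
  by (intro continuous_on_vec_lambda continuous_intros)

lemma to_torus_cbox: "to_torus ` cbox 0 1 = (UNIV :: 'd::finite torus set)"
proof -
  have "z \<in> to_torus ` cbox 0 1" for z :: "'d torus"
  proof -
    obtain x where x: "z = to_torus x" by (rule torus_cases)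
    obtain k where k: "x - int_vec k \<in> unit_cell" using unit_cell_translates_cover by blast
    have "z = to_torus (x - int_vec k)" by (simp add: x to_torus_eq_iff int_vec_def)
    moreover have "x - int_vec k \<in> cbox 0 1"
      using k by (auto simp: unit_cell_def mem_box_cart less_imp_le)
    ultimately show ?thesis by blast
  qed
  then show ?thesis by auto
qed

text \<open>The coordinates of the embedding are characters, and real and imaginary parts of a character combine
  it with its conjugate, so a real polynomial in these coordinates is a trigonometric polynomial.\<close>

lemma trig_poly_of_real_polynomial:
  assumes "real_polynomial_function q"
  shows "trig_poly (\<lambda>z. of_real (q (torus_embed z)))"
  using assms
proof (induction q)
  case (linear f)
  interpret f: bounded_linear f by (rule linear)
  have re: "trig_poly (\<lambda>z. of_real (Re (torus_char m z)))" for m :: "int ^ 'a"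
  proof -
    have "of_real (Re (torus_char m z)) = (1 / 2) * torus_char m z + (1 / 2) * torus_char (- m) z" for z
      by (simp add: torus_char_uminus_left complex_eq_iff)
    then show ?thesis by (simp only:) (intro trig_add trig_scale trig_char)
  qed
  have im: "trig_poly (\<lambda>z. of_real (Im (torus_char m z)))" for m :: "int ^ 'a"
  proof -
    have "of_real (Im (torus_char m z)) = (- \<i> / 2) * torus_char m z + (\<i> / 2) * torus_char (- m) z" for z
      by (simp add: torus_char_uminus_left complex_eq_iff)
    then show ?thesis by (simp only:) (intro trig_add trig_scale trig_char)
  qed
  have expand: "f v = (\<Sum>i\<in>UNIV. Re (v $ i) * f (axis i 1) + Im (v $ i) * f (axis i \<i>))" for v
  proof -
    have "(\<Sum>i\<in>UNIV. Re (v $ i) *\<^sub>R axis i 1 + Im (v $ i) *\<^sub>R axis i \<i>) = (\<Sum>i\<in>UNIV. axis i (v $ i))"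
      by (rule sum.cong) (auto simp: vec_eq_iff axis_def complex_eq_iff)
    also have "\<dots> = v"
      by (simp add: vec_eq_iff axis_def if_distrib cong: if_cong)
    finally have "f v = f (\<Sum>i\<in>UNIV. Re (v $ i) *\<^sub>R axis i 1 + Im (v $ i) *\<^sub>R axis i \<i>)"
      by (rule arg_cong[OF sym])
    then show ?thesis by (simp only: f.sum f.add f.scaleR real_scaleR_def)
  qed
  have "complex_of_real (f (torus_embed z)) = (\<Sum>i\<in>UNIV.
      of_real (f (axis i 1)) * of_real (Re (torus_char (axis i 1) z)) +
      of_real (f (axis i \<i>)) * of_real (Im (torus_char (axis i 1) z)))" for z :: "'a torus"
    by (subst expand) (simp add: torus_embed_def mult.commute)
  then show ?case by (simp only:) (intro trig_sum trig_add trig_scale re im)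
next
  case (const c)
  show ?case by (rule trig_const)
next
  case (add f g)
  from trig_add[OF add.IH] show ?case by simp
next
  case (mult f g)
  from trig_mult[OF mult.IH] show ?case by simp
qed

text \<open>A continuous function on the torus becomes a function \<open>G\<close> on the image of the
  embedding. It is continuous there because preimages of closed sets are images of compact subsets of
  the unit cube.\<close>

lemma trig_poly_dense:
  fixes f :: "'d::finite torus \<Rightarrow> real"
  assumes f: "continuous_on UNIV f" and e: "0 < e"
  shows "\<exists>g. trig_poly g \<and> (\<forall>z. norm (of_real (f z) - g z) < e)"
proof -
  define K where "K = range (torus_embed :: 'd torus \<Rightarrow> complex ^ 'd)"
  define \<Phi> where "\<Phi> x = torus_embed (to_torus x)" for x :: "real ^ 'd"
  define G where "G v = f (inv torus_embed v)" for v
  have G: "G (torus_embed z) = f z" for z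
    by (simp add: G_def inv_f_f[OF inj_torus_embed])
  have contf: "continuous_on UNIV (\<lambda>x. f (to_torus x))" using f by (simp add: continuous_on_torus_iff)
  have cont\<Phi>: "continuous_on A \<Phi>" for A
    unfolding \<Phi>_def using continuous_on_torus_embed continuous_on_subset by blast
  have K: "K = \<Phi> ` cbox 0 1"
    unfolding K_def \<Phi>_def to_torus_cbox[symmetric] by (simp add: image_image)
  have "compact K" unfolding K by (intro compact_continuous_image cont\<Phi> compact_cbox)
  have "continuous_on K G"
    unfolding continuous_on_closed_vimage[OF compact_imp_closed[OF \<open>compact K\<close>]]
  proof (intro allI impI)
    fix B :: "real set" assume "closed B"
    then have "closed ((\<lambda>x. f (to_torus x)) -` B)"
      by (rule closed_vimage[OF _ contf])
    then have "compact (cbox 0 1 \<inter> (\<lambda>x. f (to_torus x)) -` B)"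
      by (intro compact_Int_closed compact_cbox)
    then have "compact (\<Phi> ` (cbox 0 1 \<inter> (\<lambda>x. f (to_torus x)) -` B))"
      by (intro compact_continuous_image cont\<Phi>)
    moreover have "\<Phi> ` (cbox 0 1 \<inter> (\<lambda>x. f (to_torus x)) -` B) = G -` B \<inter> K"
      unfolding K by (auto simp: \<Phi>_def G)
    ultimately show "closed (G -` B \<inter> K)" using compact_imp_closed by metis
  qed
  then obtain q where q: "real_polynomial_function q" "\<And>v. v \<in> K \<Longrightarrow> \<bar>G v - q v\<bar> < e"
    using Stone_Weierstrass_real_polynomial_function[OF \<open>compact K\<close> _ e] by blast
  have "norm (of_real (f z) - complex_of_real (q (torus_embed z))) < e" for z
    using q(2)[of "torus_embed z"] by (simp add: K_def G flip: of_real_diff)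
  then show ?thesis using trig_poly_of_real_polynomial[OF q(1)] by blast
qed

lemma trig_poly_integrable: "trig_poly g \<Longrightarrow> integrable haar g"
proof (induction g rule: trig_poly.induct)
  case (trig_char m)
  show ?case by (rule integrable_haar_continuous[OF continuous_on_torus_char, where C = 1]) simp
qed auto

text \<open>Weyl's criterion: the convergence extends from characters to trigonometric polynomials by linearity
  and to continuous functions by uniform approximation.\<close>

lemma weak_star_conv_haarI:
  fixes y :: "nat \<Rightarrow> 'd::finite torus"
  assumes chars: "\<And>m. m \<noteq> 0 \<Longrightarrow> (\<lambda>N. (\<Sum>k<N. torus_char m (y k)) / of_nat N) \<longlonglongrightarrow> 0"
  shows "weak_star_conv (dirac_average y) haar"
  unfolding weak_star_conv_def
proof (intro allI impI)
  interpret prob_space "haar :: 'd torus measure" by (rule prob_space_haar)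
  have trig: "(\<lambda>N. (\<Sum>k<N. g (y k)) / of_nat N) \<longlonglongrightarrow> integral\<^sup>L haar g" if "trig_poly g" for g
    using that
  proof (induction g)
    case (trig_char m)
    show ?case
    proof (cases "m = 0")
      case True
      have "(\<lambda>N. (\<Sum>k<N. torus_char m (y k)) / of_nat N) \<longlonglongrightarrow> 1"
        by (intro tendsto_eventually eventually_sequentiallyI[of 1]) (simp add: True)
      then show ?thesis by (simp only: integral_haar_torus_char True if_True simp_thms)
    next
      case False
      then show ?thesis using chars[OF False] by (simp add: integral_haar_torus_char)
    qed
  next
    case (trig_add f g)
    then show ?case
      using tendsto_add[OF trig_add.IH] by (simp add: sum.distrib add_divide_distrib trig_poly_integrable)
  next
    case (trig_scale f c)
    then show ?case
      using tendsto_mult_left[OF trig_scale.IH, of c] by (simp flip: sum_distrib_left)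
  qed
  fix f :: "'d torus \<Rightarrow> real" assume f: "continuous_on UNIV f"
  have fm: "f \<in> borel_measurable borel" by (rule borel_measurable_continuous_onI[OF f])
  have avg: "integral\<^sup>L (dirac_average y N) f = (\<Sum>k<N. f (y k)) / real N" for N
    by (rule integral_dirac_average[OF fm])
  have "(\<lambda>N. (\<Sum>k<N. f (y k)) / real N) \<longlonglongrightarrow> integral\<^sup>L haar f"
  proof (rule LIMSEQ_I)
    fix e :: real assume e: "0 < e"
    obtain g where g: "trig_poly g" "\<And>z. norm (of_real (f z) - g z) < e / 3"
      using trig_poly_dense[OF f, of "e / 3"] e by auto
    have gi: "integrable haar g" by (rule trig_poly_integrable[OF g(1)])
    have di: "integrable haar (\<lambda>z. of_real (f z) - g z)"
      by (rule integrable_const_bound[where B = "e / 3"])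
        (use g(2) gi fm in \<open>auto intro!: AE_I2 less_imp_le\<close>)
    have fi: "integrable haar (\<lambda>z. complex_of_real (f z))"
      using Bochner_Integration.integrable_add[OF di gi] by simp
    have int: "norm (of_real (integral\<^sup>L haar f) - integral\<^sup>L haar g) \<le> e / 3"
    proof -
      have "of_real (integral\<^sup>L haar f) - integral\<^sup>L haar g = (\<integral>z. of_real (f z) - g z \<partial>haar)"
        by (simp add: Bochner_Integration.integral_diff[OF fi gi])
      also have "norm \<dots> \<le> (\<integral>z. norm (of_real (f z) - g z) \<partial>haar)"
        by (rule integral_norm_bound)
      also have "\<dots> \<le> (\<integral>z. e / 3 \<partial>(haar :: 'd torus measure))"
        by (rule integral_mono) (use g(2) di in \<open>auto intro: less_imp_le\<close>)
      finally show ?thesis using prob_space by simp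
    qed
    obtain n0 where n0: "\<And>N. N \<ge> n0 \<Longrightarrow>
        norm ((\<Sum>k<N. g (y k)) / of_nat N - integral\<^sup>L haar g) < e / 3"
      using LIMSEQ_D[OF trig[OF g(1)], of "e / 3"] e by auto
    show "\<exists>n0. \<forall>N\<ge>n0. norm ((\<Sum>k<N. f (y k)) / real N - integral\<^sup>L haar f) < e"
    proof (intro exI allI impI)
      fix N assume N: "N \<ge> n0"
      let ?af = "complex_of_real ((\<Sum>k<N. f (y k)) / real N)" and ?ag = "(\<Sum>k<N. g (y k)) / of_nat N"
      have 1: "norm (?af - ?ag) \<le> e / 3"
      proof (cases "N = 0")
        case False
        have "?af - ?ag = (\<Sum>k<N. of_real (f (y k)) - g (y k)) / of_nat N"
          by (simp add: sum_subtractf diff_divide_distrib)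
        also have "norm \<dots> = norm (\<Sum>k<N. of_real (f (y k)) - g (y k)) / real N"
          by (simp add: norm_divide)
        also have "\<dots> \<le> (\<Sum>k<N. e / 3) / real N"
          by (intro divide_right_mono order_trans[OF norm_sum] sum_mono less_imp_le[OF g(2)]) simp
        finally show ?thesis using False by simp
      qed (use e in simp)
      have "?af - of_real (integral\<^sup>L haar f) =
          (?af - ?ag) + (?ag - integral\<^sup>L haar g) + (integral\<^sup>L haar g - of_real (integral\<^sup>L haar f))"
        by simp
      also have "norm \<dots> \<le> norm (?af - ?ag) + norm (?ag - integral\<^sup>L haar g)
          + norm (integral\<^sup>L haar g - of_real (integral\<^sup>L haar f))"
        by (rule order_trans[OF norm_triangle_ineq add_right_mono[OF norm_triangle_ineq]])
      finally have "norm (?af - of_real (integral\<^sup>L haar f)) \<le> norm (?af - ?ag)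
          + norm (?ag - integral\<^sup>L haar g) + norm (of_real (integral\<^sup>L haar f) - integral\<^sup>L haar g)"
        by (simp only: norm_minus_commute)
      then have "norm (?af - of_real (integral\<^sup>L haar f)) < e"
        using 1 n0[OF N] int by linarith
      then show "norm ((\<Sum>k<N. f (y k)) / real N - integral\<^sup>L haar f) < e"
        by (simp only: norm_of_real real_norm_def of_real_diff[symmetric])
    qed
  qed
  then show "(\<lambda>N. integral\<^sup>L (dirac_average y N) f) \<longlonglongrightarrow> integral\<^sup>L haar f"
    by (simp only: avg)
qed

section \<open>Strong law of large numbers for a random composition of maps\<close>

text \<open>Between consecutive squares \<open>k\<^sup>2\<close> and \<open>(k + 1)\<^sup>2\<close> there are
  only \<open>2 k\<close> steps, a vanishing proportion of \<open>k\<^sup>2\<close>.\<close>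

lemma average_tendsto_zero_of_squares:
  fixes s :: "nat \<Rightarrow> real"
  assumes inc: "\<And>n. \<bar>s (Suc n) - s n\<bar> \<le> C"
    and squares: "(\<lambda>k. s (k\<^sup>2) / real (k\<^sup>2)) \<longlonglongrightarrow> 0"
  shows "(\<lambda>n. s n / real n) \<longlonglongrightarrow> 0"
proof (rule LIMSEQ_I)
  fix e :: real assume e: "0 < e"
  have C: "C \<ge> 0" using inc[of 0] by linarith
  have lip: "\<bar>s (m + j) - s m\<bar> \<le> C * j" for m j
  proof (induction j)
    case (Suc j)
    then show ?case using inc[of "m + j"] by (simp add: algebra_simps)
  qed simp
  have "(\<lambda>k. \<bar>s (k\<^sup>2) / real (k\<^sup>2)\<bar> + 2 * C / real k) \<longlonglongrightarrow> \<bar>0\<bar> + 0"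
    by (intro tendsto_add tendsto_rabs squares lim_const_over_n)
  then have "eventually (\<lambda>k. \<bar>s (k\<^sup>2) / real (k\<^sup>2)\<bar> + 2 * C / real k < e) sequentially"
    using e by (intro order_tendstoD(2)) auto
  then obtain K where K: "\<And>k. k \<ge> K \<Longrightarrow> \<bar>s (k\<^sup>2) / real (k\<^sup>2)\<bar> + 2 * C / real k < e"
    by (auto simp: eventually_sequentially)
  show "\<exists>n0. \<forall>n\<ge>n0. norm (s n / real n - 0) < e"
  proof (intro exI allI impI)
    fix n assume n: "n \<ge> (Suc K)\<^sup>2"
    define k where "k = floor_sqrt n"
    have k2: "k\<^sup>2 \<le> n" "n < (Suc k)\<^sup>2"
      unfolding k_def by (simp_all add: floor_sqrt_power2_le Suc_floor_sqrt_power2_gt)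
    have kK: "k \<ge> Suc K" unfolding k_def using n by (simp add: le_floor_sqrt_iff)
    then have k0: "k > 0" by simp
    then have n0: "n > 0" using k2(1) by (meson less_le_trans zero_less_power)
    obtain j where j: "n = k\<^sup>2 + j" using k2(1) by (auto simp: le_iff_add)
    have "j \<le> 2 * k" using k2(2) j by (simp add: power2_eq_square)
    then have jr: "real j \<le> 2 * real k" by linarith
    have "\<bar>s n\<bar> \<le> \<bar>s (k\<^sup>2)\<bar> + C * j" using lip[of "k\<^sup>2" j] j by simp
    also have "\<dots> \<le> \<bar>s (k\<^sup>2)\<bar> + C * (2 * real k)"
      using jr C by (intro add_left_mono mult_left_mono)
    finally have "\<bar>s n\<bar> / real n \<le> (\<bar>s (k\<^sup>2)\<bar> + C * (2 * real k)) / real n"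
      by (rule divide_right_mono) simp
    also have "\<dots> \<le> (\<bar>s (k\<^sup>2)\<bar> + C * (2 * real k)) / real (k\<^sup>2)"
      using C k0 n0 of_nat_mono[OF k2(1), where ?'a = real] by (intro divide_left_mono) auto
    also have "\<dots> = \<bar>s (k\<^sup>2) / real (k\<^sup>2)\<bar> + 2 * C / real k"
      using k0 by (simp add: field_simps power2_eq_square)
    also have "\<dots> < e" by (rule K) (use kK in simp)
    finally show "norm (s n / real n - 0) < e" by simp
  qed
qed

text \<open>Along the squares the second moments of the averages are at most \<open>K / k\<^sup>2\<close>, hence
  summable, so the averages tend to zero almost surely there; bounded increments fill the gaps.\<close>

lemma (in prob_space) average_tendsto_zero_of_second_moments:
  fixes S :: "nat \<Rightarrow> 'a \<Rightarrow> real"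
  assumes [measurable]: "\<And>n. S n \<in> borel_measurable M"
    and inc: "\<And>n x. \<bar>S (Suc n) x - S n x\<bar> \<le> C"
    and int: "\<And>n. integrable M (\<lambda>x. (S n x)\<^sup>2)"
    and mom: "\<And>n. expectation (\<lambda>x. (S n x)\<^sup>2) \<le> K * real n"
  shows "AE x in M. (\<lambda>n. S n x / real n) \<longlonglongrightarrow> 0"
proof -
  define f where "f k x = (S (k\<^sup>2) x / real (k\<^sup>2))\<^sup>2" for k x
  have [measurable]: "f k \<in> borel_measurable M" for k unfolding f_def by measurable
  have f0: "f k x \<ge> 0" for k x by (simp add: f_def)
  have sm: "summable (\<lambda>k. K / real (k\<^sup>2))"
    using summable_mult[OF inverse_power_summable[of 2, where ?'a = real], of K]
    by (simp add: divide_inverse)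
  have K: "K \<ge> 0"
  proof -
    have "0 \<le> expectation (\<lambda>x. (S 1 x)\<^sup>2)" by simp
    also have "\<dots> \<le> K" using mom[of 1] by simp
    finally show ?thesis .
  qed
  have "(\<integral>\<^sup>+x. (\<Sum>k. ennreal (f k x)) \<partial>M) = (\<Sum>k. \<integral>\<^sup>+x. ennreal (f k x) \<partial>M)"
    by (rule nn_integral_suminf) measurable
  also have "\<dots> \<le> (\<Sum>k. ennreal (K / real (k\<^sup>2)))"
  proof (rule suminf_le)
    fix k
    have "(\<integral>\<^sup>+x. ennreal (f k x) \<partial>M) = ennreal (expectation (f k))"
      unfolding f_def power_divide
      by (rule nn_integral_eq_integral) (auto intro!: integrable_divide int)
    also have "expectation (f k) = expectation (\<lambda>x. (S (k\<^sup>2) x)\<^sup>2) / (real (k\<^sup>2))\<^sup>2"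
      unfolding f_def power_divide by simp
    also have "\<dots> \<le> K * real (k\<^sup>2) / (real (k\<^sup>2))\<^sup>2"
      by (intro divide_right_mono mom) simp
    also have "\<dots> = K / real (k\<^sup>2)" by (simp add: power2_eq_square)
    finally show "(\<integral>\<^sup>+x. ennreal (f k x) \<partial>M) \<le> ennreal (K / real (k\<^sup>2))"
      by (simp add: ennreal_leI)
  qed auto
  also have "\<dots> = ennreal (\<Sum>k. K / real (k\<^sup>2))"
    using sm K by (intro suminf_ennreal2) auto
  also have "\<dots> < \<infinity>" by simp
  finally have "(\<integral>\<^sup>+x. (\<Sum>k. ennreal (f k x)) \<partial>M) \<noteq> \<infinity>" by simp
  then have "AE x in M. (\<Sum>k. ennreal (f k x)) \<noteq> \<infinity>"
    by (intro nn_integral_PInf_AE) auto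
  then show ?thesis
  proof eventually_elim
    case (elim x)
    have "summable (\<lambda>k. f k x)"
      by (rule summable_suminf_not_top) (use f0 elim in auto)
    then have "(\<lambda>k. f k x) \<longlonglongrightarrow> 0" by (rule summable_LIMSEQ_zero)
    then have "(\<lambda>k. sqrt (f k x)) \<longlonglongrightarrow> sqrt 0" by (rule tendsto_real_sqrt)
    then have "(\<lambda>k. \<bar>S (k\<^sup>2) x / real (k\<^sup>2)\<bar>) \<longlonglongrightarrow> 0" by (simp add: f_def)
    then have "(\<lambda>k. S (k\<^sup>2) x / real (k\<^sup>2)) \<longlonglongrightarrow> 0" by (simp only: tendsto_rabs_zero_iff)
    then show ?case by (rule average_tendsto_zero_of_squares[rotated]) (rule inc)
  qed
qed

text \<open>Peeling off the first map, rather than the last one, restarts the same walk at \<open>g x\<close>.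
  All moment computations below use this recursion together with the invariance of the product measure
  under it.\<close>

lemma walk_case_nat: "walk (case_nat g b) (Suc k) x = walk b k (g x)"
  by (induction k) auto

lemma (in sequence_space) integral_first_coordinate:
  fixes f :: "(nat \<Rightarrow> 'a) \<Rightarrow> real"
  assumes [measurable]: "f \<in> borel_measurable S" and bound: "\<And>b. \<bar>f b\<bar> \<le> C"
  shows "integral\<^sup>L S f = (\<integral>g. (\<integral>b. f (case_nat g b) \<partial>S) \<partial>M)"
proof -
  interpret MS: pair_prob_space M S ..
  have "integral\<^sup>L S f = integral\<^sup>L (distr (M \<Otimes>\<^sub>M S) S (\<lambda>(s, \<omega>). case_nat s \<omega>)) f"
    by (simp only: PiM_iter)
  also have "\<dots> = integral\<^sup>L (M \<Otimes>\<^sub>M S) (\<lambda>z. f (case z of (s, \<omega>) \<Rightarrow> case_nat s \<omega>))"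
    by (rule integral_distr) measurable
  also have "\<dots> = (\<integral>g. (\<integral>b. f (case (g, b) of (s, \<omega>) \<Rightarrow> case_nat s \<omega>) \<partial>S) \<partial>M)"
  proof (rule MS.integral_fst'[symmetric])
    show "integrable (M \<Otimes>\<^sub>M S) (\<lambda>z. f (case z of (s, \<omega>) \<Rightarrow> case_nat s \<omega>))"
      by (rule MS.P.integrable_const_bound[where B = C]) (use bound in auto)
  qed
  finally show ?thesis by simp
qed

locale finite_random_maps = sequence_space M for M :: "('a \<Rightarrow> 'a) measure" +
  assumes finite_space: "finite (space M)" and sets_M: "sets M = Pow (space M)"
begin

lemma measurable_walk: "(\<lambda>b. walk b k x) \<in> measurable S (count_space UNIV)"
proof (induction k)
  case (Suc k)
  show ?case
  proof (rule measurableI)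
    fix A :: "'a set"
    have "(\<lambda>b. walk b (Suc k) x) -` A \<inter> space S =
      (\<Union>g\<in>space M. ((\<lambda>b. b k) -` {g} \<inter> space S) \<inter> ((\<lambda>b. walk b k x) -` (g -` A) \<inter> space S))"
      by (auto simp: space_PiM PiE_iff)
    also have "\<dots> \<in> sets S"
    proof (rule sets.finite_UN[OF finite_space])
      fix g assume g: "g \<in> space M"
      have "(\<lambda>b. b k) -` {g} \<inter> space S \<in> sets S"
        by (rule measurable_sets[where A = M]) (use g in \<open>auto simp: sets_M\<close>)
      moreover have "(\<lambda>b. walk b k x) -` (g -` A) \<inter> space S \<in> sets S"
        by (rule measurable_sets[OF Suc]) simp
      ultimately show "((\<lambda>b. b k) -` {g} \<inter> space S) \<inter> ((\<lambda>b. walk b k x) -` (g -` A) \<inter> space S) \<in> sets S"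
        by (rule sets.Int)
    qed
    finally show "(\<lambda>b. walk b (Suc k) x) -` A \<inter> space S \<in> sets S" .
  qed simp
qed simp

text \<open>The transition operator of the walk: the conditional expectation of \<open>\<phi>\<close> one step
  after \<open>y\<close>.\<close>

definition step_average :: "('a \<Rightarrow> real) \<Rightarrow> 'a \<Rightarrow> real" where
  "step_average \<phi> y = (\<integral>g. \<phi> (g y) \<partial>M)"

definition compensated_sum :: "('a \<Rightarrow> real) \<Rightarrow> 'a \<Rightarrow> nat \<Rightarrow> (nat \<Rightarrow> 'a \<Rightarrow> 'a) \<Rightarrow> real" where
  "compensated_sum \<phi> x n b = (\<Sum>k<n. \<phi> (walk b (Suc k) x) - step_average \<phi> (walk b k x))"

lemma compensated_sum_case_nat:
  "compensated_sum \<phi> x (Suc n) (case_nat g b) = (\<phi> (g x) - step_average \<phi> x) + compensated_sum \<phi> (g x) n b"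
  unfolding compensated_sum_def sum.lessThan_Suc_shift by (simp add: walk_case_nat del: walk.simps(2))

lemma measurable_compensated_sum [measurable]: "compensated_sum \<phi> x n \<in> borel_measurable S"
proof -
  have "(\<lambda>b. \<psi> (walk b k x)) \<in> borel_measurable S" for \<psi> :: "'a \<Rightarrow> real" and k
    by (rule measurable_compose[OF measurable_walk]) simp
  then show ?thesis unfolding compensated_sum_def by measurable
qed

lemma integrable_M [simp]: "integrable M f" for f :: "('a \<Rightarrow> 'a) \<Rightarrow> real"
proof (rule M.integrable_const_bound[where B = "Max (insert 0 ((\<lambda>g. \<bar>f g\<bar>) ` space M))"])
  show "AE g in M. norm (f g) \<le> Max (insert 0 ((\<lambda>g. \<bar>f g\<bar>) ` space M))"
    by (rule AE_I2) (use finite_space in \<open>auto intro!: Max_ge\<close>)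
  show "f \<in> borel_measurable M"
    by (rule measurableI) (auto simp: sets_M)
qed

context
  fixes \<phi> :: "'a \<Rightarrow> real"
  assumes \<phi>: "\<And>x. \<bar>\<phi> x\<bar> \<le> 1"
begin

lemma abs_step_average_le: "\<bar>step_average \<phi> y\<bar> \<le> 1"
proof -
  have "\<bar>step_average \<phi> y\<bar> \<le> (\<integral>g. \<bar>\<phi> (g y)\<bar> \<partial>M)" unfolding step_average_def by (rule integral_abs_bound)
  also have "\<dots> \<le> (\<integral>g. 1 \<partial>M)" by (rule integral_mono) (auto simp: \<phi>)
  finally show ?thesis by (simp add: M.prob_space)
qed

lemma abs_increment_le: "\<bar>\<phi> x - step_average \<phi> y\<bar> \<le> 2"
  using \<phi>[of x] abs_step_average_le[of y] by linarith

lemma abs_compensated_sum_le: "\<bar>compensated_sum \<phi> x n b\<bar> \<le> 2 * real n"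
proof -
  have "\<bar>compensated_sum \<phi> x n b\<bar> \<le> (\<Sum>k<n. 2)"
    unfolding compensated_sum_def by (rule order_trans[OF sum_abs sum_mono]) (rule abs_increment_le)
  then show ?thesis by simp
qed

lemma abs_compensated_sum_sq_le: "\<bar>(compensated_sum \<phi> x n b)\<^sup>2\<bar> \<le> (2 * real n)\<^sup>2"
  using power_mono[OF abs_compensated_sum_le[of x n b], of 2] by simp

lemma integrable_compensated_sum: "integrable S (compensated_sum \<phi> x n)"
  by (rule P.integrable_const_bound[where B = "2 * real n"]) (auto simp: abs_compensated_sum_le)

lemma integrable_compensated_sum_sq: "integrable S (\<lambda>b. (compensated_sum \<phi> x n b)\<^sup>2)"
  by (rule P.integrable_const_bound[where B = "(2 * real n)\<^sup>2"]) (use abs_compensated_sum_sq_le in auto)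

lemma integral_compensated_sum: "integral\<^sup>L S (compensated_sum \<phi> x n) = 0"
proof (induction n arbitrary: x)
  case 0
  then show ?case by (simp add: compensated_sum_def[abs_def])
next
  case (Suc n)
  have "integral\<^sup>L S (compensated_sum \<phi> x (Suc n)) =
      (\<integral>g. (\<integral>b. compensated_sum \<phi> x (Suc n) (case_nat g b) \<partial>S) \<partial>M)"
    by (rule integral_first_coordinate[OF measurable_compensated_sum abs_compensated_sum_le])
  also have "\<dots> = (\<integral>g. \<phi> (g x) - step_average \<phi> x \<partial>M)"
    by (simp add: compensated_sum_case_nat integrable_compensated_sum Suc P.prob_space)
  also have "\<dots> = 0" by (simp add: M.prob_space step_average_def)
  finally show ?case .
qed

text \<open>Conditioning on the first map \<open>g\<close> splits the sum into a number \<open>z\<close> with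
  \<open>\<bar>z\<bar> \<le> 2\<close> and the same kind of sum started at \<open>g x\<close>. The
  latter has mean zero, so the cross term disappears, and the bound must hold for all starting points
  at once for the induction to close.\<close>

lemma integral_compensated_sum_sq_le: "(\<integral>b. (compensated_sum \<phi> x n b)\<^sup>2 \<partial>S) \<le> 4 * real n"
proof (induction n arbitrary: x)
  case 0
  then show ?case by (simp add: compensated_sum_def[abs_def])
next
  case (Suc n)
  have inner: "(\<integral>b. (compensated_sum \<phi> x (Suc n) (case_nat g b))\<^sup>2 \<partial>S) \<le> 4 * real (Suc n)" for g
  proof -
    define z where "z = \<phi> (g x) - step_average \<phi> x"
    have "(\<integral>b. (compensated_sum \<phi> x (Suc n) (case_nat g b))\<^sup>2 \<partial>S)
        = (\<integral>b. z\<^sup>2 + 2 * z * compensated_sum \<phi> (g x) n b + (compensated_sum \<phi> (g x) n b)\<^sup>2 \<partial>S)"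
      by (simp add: compensated_sum_case_nat z_def[symmetric] power2_sum algebra_simps)
    also have "\<dots> = z\<^sup>2 + (\<integral>b. (compensated_sum \<phi> (g x) n b)\<^sup>2 \<partial>S)"
      by (simp add: integrable_compensated_sum integrable_compensated_sum_sq integral_compensated_sum P.prob_space)
    also have "\<dots> \<le> 2\<^sup>2 + 4 * real n"
      using power_mono[OF abs_increment_le[of "g x" x], of 2] Suc[of "g x"]
      by (simp add: z_def)
    finally show ?thesis by simp
  qed
  have "(\<integral>b. (compensated_sum \<phi> x (Suc n) b)\<^sup>2 \<partial>S) =
      (\<integral>g. (\<integral>b. (compensated_sum \<phi> x (Suc n) (case_nat g b))\<^sup>2 \<partial>S) \<partial>M)"
    by (rule integral_first_coordinate[OF _ abs_compensated_sum_sq_le]) measurable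
  also have "\<dots> \<le> (\<integral>g. 4 * real (Suc n) \<partial>M)"
    by (rule integral_mono) (auto simp: inner simp del: of_nat_Suc)
  finally show ?case by (simp add: M.prob_space)
qed

lemma AE_average_step:
  "AE b in S. (\<lambda>n. (\<Sum>k<n. \<phi> (walk b (Suc k) x) - step_average \<phi> (walk b k x)) / real n) \<longlonglongrightarrow> 0"
proof -
  have "AE b in S. (\<lambda>n. compensated_sum \<phi> x n b / real n) \<longlonglongrightarrow> 0"
  proof (rule P.average_tendsto_zero_of_second_moments)
    show "\<bar>compensated_sum \<phi> x (Suc n) b - compensated_sum \<phi> x n b\<bar> \<le> 2" for n b
      using abs_increment_le by (simp add: compensated_sum_def)
  qed (use integrable_compensated_sum_sq integral_compensated_sum_sq_le in auto)
  then show ?thesis by (simp add: compensated_sum_def)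
qed

end

end

section \<open>Vanishing of the character averages\<close>

text \<open>The upper limit of a nonnegative bounded real sequence, as the least asymptotic upper bound; in this
  form it is a real number.\<close>

definition upper_limit :: "(nat \<Rightarrow> real) \<Rightarrow> real" where
  "upper_limit a = Inf {C. eventually (\<lambda>N. a N \<le> C) sequentially}"

lemma
  fixes a :: "nat \<Rightarrow> real"
  assumes a: "\<And>N. 0 \<le> a N"
  shows upper_limit_le: "eventually (\<lambda>N. a N \<le> C) sequentially \<Longrightarrow> upper_limit a \<le> C"
    and upper_limit_nonneg: "eventually (\<lambda>N. a N \<le> C) sequentially \<Longrightarrow> 0 \<le> upper_limit a"
    and eventually_le_upper_limit:
      "eventually (\<lambda>N. a N \<le> C) sequentially \<Longrightarrow> 0 < e \<Longrightarrow> eventually (\<lambda>N. a N \<le> upper_limit a + e) sequentially"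
proof -
  let ?X = "{C. eventually (\<lambda>N. a N \<le> C) sequentially}"
  have pos: "0 \<le> C" if ev: "eventually (\<lambda>N. a N \<le> C) sequentially" for C
  proof -
    obtain N where "a N \<le> C" using ev by (auto simp: eventually_sequentially)
    then show ?thesis using a[of N] by linarith
  qed
  then have bdd: "bdd_below ?X" by (intro bdd_belowI[of _ 0]) auto
  show "upper_limit a \<le> C" if "eventually (\<lambda>N. a N \<le> C) sequentially"
    unfolding upper_limit_def by (rule cInf_lower[OF _ bdd]) (use that in auto)
  show "0 \<le> upper_limit a" if "eventually (\<lambda>N. a N \<le> C) sequentially"
    unfolding upper_limit_def by (rule cInf_greatest) (use that pos in auto)
  show "eventually (\<lambda>N. a N \<le> upper_limit a + e) sequentially"
    if C: "eventually (\<lambda>N. a N \<le> C) sequentially" and e: "0 < e"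
  proof -
    have "\<exists>B\<in>?X. B < upper_limit a + e"
      unfolding upper_limit_def by (rule cInf_lessD) (use C e in auto)
    then obtain B where B: "eventually (\<lambda>N. a N \<le> B) sequentially" "B < upper_limit a + e" by auto
    show ?thesis by (rule eventually_mono[OF B(1)]) (use B(2) in linarith)
  qed
qed

lemma upper_limit_subadditive:
  fixes a :: "nat \<Rightarrow> real" and b :: "'j \<Rightarrow> nat \<Rightarrow> real"
  assumes J: "finite J" and q: "\<And>j. j \<in> J \<Longrightarrow> 0 \<le> q j"
    and a: "\<And>N. 0 \<le> a N" and b: "\<And>j N. j \<in> J \<Longrightarrow> 0 \<le> b j N" "\<And>j N. j \<in> J \<Longrightarrow> b j N \<le> C"
    and le: "\<And>N. a N \<le> (\<Sum>j\<in>J. q j * b j N) + e N" and e: "e \<longlonglongrightarrow> 0"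
  shows "upper_limit a \<le> (\<Sum>j\<in>J. q j * upper_limit (b j))"
proof (rule field_le_epsilon)
  fix \<epsilon> :: real assume eps: "0 < \<epsilon>"
  define Q where "Q = sum q J"
  have Q: "Q \<ge> 0" unfolding Q_def by (rule sum_nonneg) (rule q)
  define \<eta> where "\<eta> = \<epsilon> / (Q + 1)"
  have eta: "\<eta> > 0" "\<eta> * (Q + 1) = \<epsilon>" using eps Q by (auto simp: \<eta>_def)
  have "eventually (\<lambda>N. \<forall>j\<in>J. b j N \<le> upper_limit (b j) + \<eta>) sequentially"
  proof (rule eventually_ball_finite[OF J], rule ballI)
    fix j assume j: "j \<in> J"
    show "eventually (\<lambda>N. b j N \<le> upper_limit (b j) + \<eta>) sequentially"
      by (rule eventually_le_upper_limit[where C = C]) (use b j eta in auto)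
  qed
  moreover have "eventually (\<lambda>N. e N < \<eta>) sequentially"
    using e eta(1) by (rule order_tendstoD)
  ultimately have "eventually (\<lambda>N. a N \<le> (\<Sum>j\<in>J. q j * upper_limit (b j)) + \<epsilon>) sequentially"
  proof eventually_elim
    case (elim N)
    have "a N \<le> (\<Sum>j\<in>J. q j * b j N) + e N" by (rule le)
    also have "(\<Sum>j\<in>J. q j * b j N) \<le> (\<Sum>j\<in>J. q j * (upper_limit (b j) + \<eta>))"
      using elim(1) q by (intro sum_mono mult_left_mono) auto
    also have "\<dots> = (\<Sum>j\<in>J. q j * upper_limit (b j)) + \<eta> * Q"
      by (simp add: Q_def distrib_left sum.distrib sum_distrib_left mult.commute)
    finally show ?case using elim(2) eta(2) by (simp add: distrib_left)
  qed
  then show "upper_limit a \<le> (\<Sum>j\<in>J. q j * upper_limit (b j)) + \<epsilon>"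
    by (rule upper_limit_le[OF a])
qed

lemma tendsto_zero_of_upper_limit:
  assumes "\<And>N. 0 \<le> a N" "\<And>N. a N \<le> C" "upper_limit a = 0"
  shows "a \<longlonglongrightarrow> 0"
proof (rule order_tendstoI)
  fix l :: real assume "l < 0"
  then show "eventually (\<lambda>N. l < a N) sequentially"
    using assms(1) by (auto intro: always_eventually less_le_trans)
next
  fix u :: real assume "0 < u"
  then have "eventually (\<lambda>N. a N \<le> upper_limit a + u / 2) sequentially"
    by (intro eventually_le_upper_limit[where C = C]) (use assms in auto)
  then show "eventually (\<lambda>N. a N < u) sequentially"
    by (rule eventually_mono) (use \<open>0 < u\<close> assms(3) in linarith)
qed

lemma integral_finite_discrete:
  fixes \<phi> :: "'a \<Rightarrow> real"
  assumes "finite_measure M" "finite (space M)" "sets M = Pow (space M)"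
  shows "integral\<^sup>L M \<phi> = (\<Sum>g\<in>space M. measure M {g} * \<phi> g)"
proof -
  interpret finite_measure M by fact
  have "integral\<^sup>L M \<phi> = (\<integral>g. (\<Sum>y\<in>space M. indicator {y} g * \<phi> y) \<partial>M)"
  proof (rule Bochner_Integration.integral_cong[OF refl])
    fix g assume "g \<in> space M"
    then show "\<phi> g = (\<Sum>y\<in>space M. indicator {y} g * \<phi> y)"
      using assms(2) by (simp add: indicator_def if_distrib if_distribR cong: if_cong)
  qed
  also have "\<dots> = (\<Sum>y\<in>space M. (\<integral>g. indicator {y} g * \<phi> y \<partial>M))"
    by (rule Bochner_Integration.integral_sum)
      (auto intro!: integrable_mult_left integrable_real_indicator simp: assms(3) emeasure_eq_measure)
  also have "\<dots> = (\<Sum>g\<in>space M. measure M {g} * \<phi> g)"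
    by (rule sum.cong) (auto simp: assms(3))
  finally show ?thesis .
qed

text \<open>The maps \<open>h i\<close> may coincide for different indices; the mass of a map is then shared
  equally among its indices, which keeps every weight positive.\<close>

lemma integral_indexed_discrete:
  fixes h :: "'i \<Rightarrow> 'a" and \<phi> :: "'a \<Rightarrow> real"
  assumes M: "prob_space M" and I: "finite I" and space: "space M = h ` I" "sets M = Pow (h ` I)"
  shows "integral\<^sup>L M \<phi> = (\<Sum>i\<in>I. measure M {h i} / card {j\<in>I. h j = h i} * \<phi> (h i))"
proof -
  interpret prob_space M by fact
  have "integral\<^sup>L M \<phi> = (\<Sum>g\<in>h ` I. measure M {g} * \<phi> g)"
    using integral_finite_discrete[OF finite_measure_axioms, of \<phi>] I space by simp
  also have "\<dots> = (\<Sum>g\<in>h ` I. \<Sum>i\<in>{i\<in>I. h i = g}. measure M {h i} / card {j\<in>I. h j = h i} * \<phi> (h i))"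
  proof (rule sum.cong[OF refl])
    fix g assume g: "g \<in> h ` I"
    then have "card {j\<in>I. h j = g} \<noteq> 0" using I by auto
    then show "measure M {g} * \<phi> g =
        (\<Sum>i\<in>{i\<in>I. h i = g}. measure M {h i} / card {j\<in>I. h j = h i} * \<phi> (h i))"
      by simp
  qed
  also have "\<dots> = (\<Sum>i\<in>I. measure M {h i} / card {j\<in>I. h j = h i} * \<phi> (h i))"
    by (rule sum.image_gen[symmetric, OF I])
  finally show ?thesis .
qed

text \<open>Otherwise the closed subgroup on which the character \<open>e\<^sub>m\<close> is trivial would
  contain all points \<open>c i j\<close>, and it is proper for nonzero \<open>m\<close>.\<close>

lemma pairing_not_Ints_of_separating:
  fixes c :: "'i \<Rightarrow> 'i \<Rightarrow> real ^ 'd"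
  assumes "\<And>H. closed H \<Longrightarrow> add_subgroup H \<Longrightarrow> {to_torus (c i j) | i j. i \<in> I \<and> j \<in> I} \<subseteq> H \<Longrightarrow> H = UNIV"
    and "m \<noteq> 0"
  shows "\<exists>i\<in>I. \<exists>j\<in>I. pairing m (c i j) \<notin> \<int>"
proof (rule ccontr)
  assume "\<not> ?thesis"
  then have int: "pairing m (c i j) \<in> \<int>" if "i \<in> I" "j \<in> I" for i j using that by blast
  define H where "H = {z. torus_char m z = 1}"
  have "closed H"
    unfolding H_def by (intro closed_Collect_eq continuous_on_torus_char continuous_on_const)
  moreover have "add_subgroup H"
  proof -
    have "torus_char m (- z) * torus_char m z = 1" for z by (simp flip: torus_char_add_right)
    then show ?thesis by (auto simp: add_subgroup_def H_def torus_char_add_right) (metis mult.right_neutral)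
  qed
  moreover have "{to_torus (c i j) | i j. i \<in> I \<and> j \<in> I} \<subseteq> H"
    using int by (auto simp: H_def torus_char_to_torus)
  ultimately have "H = UNIV" by (rule assms(1))
  with exists_torus_char_neq_one[OF assms(2)] show False by (auto simp: H_def)
qed

text \<open>A statement about one fixed sequence: if its character averages are asymptotically invariant under
  the transition operator, they vanish in the limit. The operator \<open>T\<close> is the transition
  operator read on frequencies, and the two subharmonic inequalities for the upper limits
  \<open>F\<close> come from one and two applications of \<open>T\<close>.\<close>

lemma char_averages_vanish:
  fixes D :: "nat \<Rightarrow> int ^ 'd ^ 'd" and \<alpha> :: "nat \<Rightarrow> real ^ 'd" and p :: "nat \<Rightarrow> real"
    and y :: "nat \<Rightarrow> 'd torus"
  assumes I: "finite I"
    and comm: "\<And>i j. i \<in> I \<Longrightarrow> j \<in> I \<Longrightarrow> D i ** D j = D j ** D i"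
    and expanding: "\<And>i. i \<in> I \<Longrightarrow> expanding (D i)"
    and p: "\<And>i. i \<in> I \<Longrightarrow> 0 < p i" "sum p I = 1"
    and separating: "\<And>m. m \<noteq> 0 \<Longrightarrow> \<exists>i\<in>I. \<exists>j\<in>I.
      pairing m ((mat 1 - map_matrix of_int (D i)) *v \<alpha> j - (mat 1 - map_matrix of_int (D j)) *v \<alpha> i) \<notin> \<int>"
    and markov: "\<And>m. (\<lambda>N. (\<Sum>k<N. torus_char m (y (Suc k)) -
        (\<Sum>i\<in>I. of_real (p i) * torus_char m (toral_endo (D i) (y k) + to_torus (\<alpha> i)))) / of_nat N) \<longlonglongrightarrow> 0"
    and m: "m \<noteq> 0"
  shows "(\<lambda>N. (\<Sum>k<N. torus_char m (y k)) / of_nat N) \<longlonglongrightarrow> 0"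
proof -
  define c where "c i j = (mat 1 - map_matrix of_int (D i)) *v \<alpha> j - (mat 1 - map_matrix of_int (D j)) *v \<alpha> i" for i j
  define f where "f N m = (\<Sum>k<N. torus_char m (y k)) / of_nat N" for N m
  define e where "e m i = cis (2 * pi * pairing m (\<alpha> i))" for m i
  define T where "T g m = (\<Sum>i\<in>I. of_real (p i) * e m i * g (m v* D i))" for g :: "int ^ 'd \<Rightarrow> complex" and m
  define r where "r N m = f N m - T (f N) m" for N m
  have f1: "norm (f N m) \<le> 1" for N m
  proof (cases "N = 0")
    case False
    have "norm (\<Sum>k<N. torus_char m (y k)) \<le> (\<Sum>k<N. 1)"
      by (rule order_trans[OF norm_sum]) simp
    then show ?thesis using False by (simp add: f_def norm_divide)
  qed (simp add: f_def)
  have T_avg: "T (f N) m = (\<Sum>k<N. \<Sum>i\<in>I. of_real (p i) * torus_char m (toral_endo (D i) (y k) + to_torus (\<alpha> i))) / of_nat N" for N m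
    unfolding T_def f_def e_def torus_char_add_right torus_char_toral_endo torus_char_to_torus sum_divide_distrib sum_distrib_left
    by (subst sum.swap) (simp add: mult_ac)
  have r0: "(\<lambda>N. r N m) \<longlonglongrightarrow> 0" for m
  proof -
    have tel: "(\<Sum>k<N. torus_char m (y (Suc k)) - torus_char m (y k)) = torus_char m (y N) - torus_char m (y 0)" for N
      by (rule sum_lessThan_telescope)
    have split: "r N m = (\<Sum>k<N. torus_char m (y (Suc k)) -
        (\<Sum>i\<in>I. of_real (p i) * torus_char m (toral_endo (D i) (y k) + to_torus (\<alpha> i)))) / of_nat N
        - (torus_char m (y N) - torus_char m (y 0)) / of_nat N" for N
      unfolding r_def T_avg f_def tel[symmetric] by (simp add: sum_subtractf diff_divide_distrib)
    have "(\<lambda>N. (torus_char m (y N) - torus_char m (y 0)) / of_nat N) \<longlonglongrightarrow> 0"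
    proof (rule Lim_null_comparison)
      show "eventually (\<lambda>N. norm ((torus_char m (y N) - torus_char m (y 0)) / of_nat N) \<le> 2 / real N) sequentially"
      proof (intro always_eventually allI)
        fix N
        have "norm (torus_char m (y N) - torus_char m (y 0)) \<le> 2"
          using norm_triangle_ineq4[of "torus_char m (y N)" "torus_char m (y 0)"] by simp
        then show "norm ((torus_char m (y N) - torus_char m (y 0)) / of_nat N) \<le> 2 / real N"
          by (simp add: norm_divide divide_right_mono)
      qed
    qed (rule lim_const_over_n)
    from tendsto_diff[OF markov[of m] this] show ?thesis unfolding split by simp
  qed
  have norm_e: "norm (e m i) = 1" for m i by (simp add: e_def)
  define F where "F m = upper_limit (\<lambda>N. norm (f N m))" for m
  have "F m = 0"
  proof (rule vanishing_of_twisted_subharmonic[where I = I and D = D and p = p and c = c and F = F])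
    fix m
    have ev: "eventually (\<lambda>N. norm (f N m) \<le> 1) sequentially" by (simp add: f1)
    show "0 \<le> F m" unfolding F_def by (rule upper_limit_nonneg[OF _ ev]) simp
    show "F m \<le> 1" unfolding F_def by (rule upper_limit_le[OF _ ev]) simp
    show "F m \<le> (\<Sum>i\<in>I. p i * F (m v* D i))"
      unfolding F_def
    proof (rule upper_limit_subadditive[where C = 1 and e = "\<lambda>N. norm (r N m)"])
      fix N
      have "norm (f N m) \<le> norm (T (f N) m) + norm (r N m)"
        using norm_triangle_ineq[of "T (f N) m" "r N m"] by (simp add: r_def)
      also have "norm (T (f N) m) \<le> (\<Sum>i\<in>I. p i * norm (f N (m v* D i)))"
        unfolding T_def
        by (rule order_trans[OF norm_sum])
          (use p(1) in \<open>auto intro!: sum_mono simp: norm_mult norm_e less_imp_le\<close>)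
      finally show "norm (f N m) \<le> (\<Sum>i\<in>I. p i * norm (f N (m v* D i))) + norm (r N m)" by simp
    qed (use I p f1 tendsto_norm_zero[OF r0] in \<open>auto intro: less_imp_le\<close>)
    show "F m \<le> (\<Sum>(i, j)\<in>I \<times> I. (p i * p j) *
          (norm (1 + cis (2 * pi * pairing m (c i j))) / 2 * F (m v* D i v* D j)))"
    proof -
      define w where "w i j = norm (1 + cis (2 * pi * pairing m (c i j))) / 2" for i j
      define R where "R N = norm (r N m) + norm (T (r N) m)" for N
      have R0: "R \<longlonglongrightarrow> 0"
      proof -
        have "(\<lambda>N. T (r N) m) \<longlonglongrightarrow> (\<Sum>i\<in>I. of_real (p i) * e m i * 0)"
          unfolding T_def by (intro tendsto_sum tendsto_mult tendsto_const r0)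
        then have "(\<lambda>N. norm (T (r N) m)) \<longlonglongrightarrow> 0" by (intro tendsto_norm_zero) simp
        from tendsto_add[OF tendsto_norm_zero[OF r0[of m]] this] show ?thesis
          by (simp add: R_def[abs_def])
      qed
      \<comment> \<open>The phase of the two steps \<open>j\<close> then \<open>i\<close>; exchanging the steps multiplies
        it by \<open>cis (2 * pi * pairing m (c i j))\<close>.\<close>
      define E where "E i j = e m i * e (m v* D i) j" for i j
      have E: "E i j = cis (2 * pi * pairing m (\<alpha> i + map_matrix of_int (D i) *v \<alpha> j))" for i j
        by (simp add: E_def e_def cis_mult pairing_add_right pairing_matrix distrib_left)
      have w: "norm (E i j + E j i) / 2 = w i j" for i j
      proof -
        have "E j i = E i j * cis (2 * pi * pairing m (c i j))"
          unfolding E cis_mult c_def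
          by (simp add: pairing_add_right pairing_diff_right matrix_vector_mult_diff_rdistrib algebra_simps)
        then have "E i j + E j i = E i j * (1 + cis (2 * pi * pairing m (c i j)))"
          by (simp add: distrib_left)
        then show ?thesis by (simp add: w_def norm_mult E)
      qed
      have TT: "norm (T (T g) m) \<le> (\<Sum>(i, j)\<in>I \<times> I. p i * p j * (w i j * norm (g (m v* D i v* D j))))" for g
      proof -
        let ?t = "\<lambda>i j. of_real (p i * p j) * E i j * g (m v* D i v* D j)"
        have sym: "m v* D j v* D i = m v* D i v* D j" if "i \<in> I" "j \<in> I" for i j
          using comm[OF that] by (simp add: vector_matrix_mul_assoc)
        have "T (T g) m = (\<Sum>i\<in>I. \<Sum>j\<in>I. ?t i j)"
          unfolding T_def E_def sum_distrib_left by (simp add: mult_ac)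
        moreover have "(\<Sum>i\<in>I. \<Sum>j\<in>I. ?t i j) = (\<Sum>i\<in>I. \<Sum>j\<in>I. ?t j i)"
          by (rule sum.swap)
        ultimately have "T (T g) m = ((\<Sum>i\<in>I. \<Sum>j\<in>I. ?t i j) + (\<Sum>i\<in>I. \<Sum>j\<in>I. ?t j i)) / 2"
          by simp
        also have "\<dots> = (\<Sum>i\<in>I. \<Sum>j\<in>I. (?t i j + ?t j i) / 2)"
          by (simp add: sum.distrib flip: sum_divide_distrib)
        also have "\<dots> = (\<Sum>(i, j)\<in>I \<times> I. (?t i j + ?t j i) / 2)"
          by (rule sum.cartesian_product)
        also have "norm \<dots> \<le> (\<Sum>(i, j)\<in>I \<times> I. p i * p j * (w i j * norm (g (m v* D i v* D j))))"
        proof (rule order_trans[OF norm_sum sum_mono], clarify)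
          fix i j assume ij: "i \<in> I" "j \<in> I"
          have "(?t i j + ?t j i) / 2 = of_real (p i * p j) * ((E i j + E j i) / 2) * g (m v* D i v* D j)"
            unfolding sym[OF ij] by (simp add: algebra_simps add_divide_distrib)
          then have "norm ((?t i j + ?t j i) / 2) =
              norm (complex_of_real (p i * p j)) * norm ((E i j + E j i) / 2) * norm (g (m v* D i v* D j))"
            by (simp only: norm_mult)
          also have "norm (complex_of_real (p i * p j)) = p i * p j"
            unfolding norm_of_real using p(1)[OF ij(1)] p(1)[OF ij(2)] by simp
          also have "norm ((E i j + E j i) / 2) = w i j"
            using w[of i j] by (simp add: norm_divide)
          finally show "norm ((?t i j + ?t j i) / 2) \<le> p i * p j * (w i j * norm (g (m v* D i v* D j)))"
            by (simp only: mult.assoc order_refl)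
        qed
        finally show ?thesis .
      qed
      have Tdiff: "T (f N) m = T (r N) m + T (T (f N)) m" for N
        unfolding T_def[of "r N"] r_def
        by (simp add: right_diff_distrib sum_subtractf T_def)
      have "upper_limit (\<lambda>N. norm (f N m)) \<le>
          (\<Sum>z\<in>I \<times> I. (case z of (i, j) \<Rightarrow> p i * p j * w i j) * upper_limit (\<lambda>N. case z of (i, j) \<Rightarrow> norm (f N (m v* D i v* D j))))"
      proof (rule upper_limit_subadditive[where C = 1 and e = R])
        fix N
        have "f N m = (r N m + T (r N) m) + T (T (f N)) m"
          using Tdiff[of N] by (simp add: r_def)
        then have "norm (f N m) \<le> norm (r N m + T (r N) m) + norm (T (T (f N)) m)"
          by (metis norm_triangle_ineq)
        also have "\<dots> \<le> R N + norm (T (T (f N)) m)"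
          by (simp add: R_def norm_triangle_ineq)
        also have "\<dots> \<le> R N + (\<Sum>(i, j)\<in>I \<times> I. p i * p j * (w i j * norm (f N (m v* D i v* D j))))"
          by (intro add_left_mono TT)
        finally show "norm (f N m) \<le>
            (\<Sum>z\<in>I \<times> I. (case z of (i, j) \<Rightarrow> p i * p j * w i j) * (case z of (i, j) \<Rightarrow> norm (f N (m v* D i v* D j)))) + R N"
          by (simp add: case_prod_unfold mult.assoc)
      qed (use I less_imp_le[OF p(1)] f1 R0 in \<open>auto intro!: mult_nonneg_nonneg simp: w_def\<close>)
      then show ?thesis
        by (simp add: F_def w_def case_prod_unfold mult.assoc)
    qed
  qed (use I comm expanding p separating m in \<open>auto simp: c_def\<close>)
  then have "(\<lambda>N. norm (f N m)) \<longlonglongrightarrow> 0"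
    by (intro tendsto_zero_of_upper_limit[where C = 1]) (auto simp: f1 F_def)
  then show ?thesis unfolding f_def by (rule tendsto_norm_zero_cancel)
qed

theorem corollary2:
  fixes n :: nat
    and D :: "nat \<Rightarrow> int ^ 'd ^ 'd"
    and \<alpha> :: "nat \<Rightarrow> real ^ 'd"
    and h :: "nat \<Rightarrow> 'd torus \<Rightarrow> 'd torus"
    and \<mu> :: "('d torus \<Rightarrow> 'd torus) measure"
  assumes commuting: "\<And>i j. i \<in> {1..n} \<Longrightarrow> j \<in> {1..n} \<Longrightarrow> D i ** D j = D j ** D i"
    and expanding: "\<And>i. i \<in> {1..n} \<Longrightarrow> expanding (D i)"
    and h: "\<And>i x. i \<in> {1..n} \<Longrightarrow> h i x = toral_endo (D i) x + to_torus (\<alpha> i)"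
    and not_in_proper_subgroup:
      "\<And>H. closed H \<Longrightarrow> add_subgroup H \<Longrightarrow>
        {to_torus ((mat 1 - map_matrix of_int (D i)) *v \<alpha> j
            - (mat 1 - map_matrix of_int (D j)) *v \<alpha> i) | i j. i \<in> {1..n} \<and> j \<in> {1..n}} \<subseteq> H \<Longrightarrow>
        H = UNIV"
    and "prob_space \<mu>"
    and "space \<mu> = h ` {1..n}"
    and "sets \<mu> = Pow (h ` {1..n})"
    and "\<And>i. i \<in> {1..n} \<Longrightarrow> measure \<mu> {h i} > 0"
  shows "\<forall>x. AE b in (\<Pi>\<^sub>M k\<in>(UNIV :: nat set). \<mu>).
           weak_star_conv (dirac_average (\<lambda>k. walk b k x)) haar"
proof
  fix x
  define I where "I = {1..n}"
  have I: "finite I" by (simp add: I_def)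
  interpret mu: prob_space \<mu> by fact
  interpret finite_random_maps \<mu>
    by unfold_locales (use assms(6,7) in auto)
  define p where "p i = measure \<mu> {h i} / card {j\<in>I. h j = h i}" for i
  have integral: "integral\<^sup>L \<mu> \<phi> = (\<Sum>i\<in>I. p i * \<phi> (h i))" for \<phi> :: "_ \<Rightarrow> real"
    unfolding p_def using integral_indexed_discrete[OF \<open>prob_space \<mu>\<close> I, of h \<phi>] assms(6,7) by (simp add: I_def)
  have p0: "0 < p i" if "i \<in> I" for i
  proof -
    have "card {j\<in>I. h j = h i} > 0" using that I by (auto simp: card_gt_0_iff)
    then show ?thesis using assms(8)[of i] that by (simp add: p_def I_def)
  qed
  have p1: "sum p I = 1" using integral[of "\<lambda>_. 1"] by (simp add: mu.prob_space)
  have mk: "step_average \<phi> z = (\<Sum>i\<in>I. p i * \<phi> (toral_endo (D i) z + to_torus (\<alpha> i)))" for \<phi> z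
    unfolding step_average_def integral by (rule sum.cong) (auto simp: h I_def)
  have re: "AE b in S. \<forall>m. (\<lambda>N. (\<Sum>k<N. Re (torus_char m (walk b (Suc k) x)) - step_average (\<lambda>z. Re (torus_char m z)) (walk b k x)) / real N) \<longlonglongrightarrow> 0"
    unfolding AE_all_countable
    by (intro allI AE_average_step) (metis abs_Re_le_cmod norm_torus_char)
  have im: "AE b in S. \<forall>m. (\<lambda>N. (\<Sum>k<N. Im (torus_char m (walk b (Suc k) x)) - step_average (\<lambda>z. Im (torus_char m z)) (walk b k x)) / real N) \<longlonglongrightarrow> 0"
    unfolding AE_all_countable
    by (intro allI AE_average_step) (metis abs_Im_le_cmod norm_torus_char)
  show "AE b in S. weak_star_conv (dirac_average (\<lambda>k. walk b k x)) haar"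
    using re im
  proof eventually_elim
    case (elim b)
    show ?case
    proof (rule weak_star_conv_haarI,
        rule char_averages_vanish[where I = I and D = D and \<alpha> = \<alpha> and p = p])
      fix m
      show "(\<lambda>N. (\<Sum>k<N. torus_char m (walk b (Suc k) x) -
          (\<Sum>i\<in>I. of_real (p i) * torus_char m (toral_endo (D i) (walk b k x) + to_torus (\<alpha> i)))) / of_nat N) \<longlonglongrightarrow> 0"
        unfolding tendsto_complex_iff
        using elim[rule_format, of m]
        by (simp add: mk Re_divide_of_nat Im_divide_of_nat Re_sum Im_sum del: walk.simps(2))
    next
      fix m :: "int ^ 'd" assume "m \<noteq> 0"
      show "\<exists>i\<in>I. \<exists>j\<in>I. pairing m ((mat 1 - map_matrix of_int (D i)) *v \<alpha> j
          - (mat 1 - map_matrix of_int (D j)) *v \<alpha> i) \<notin> \<int>"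
        using not_in_proper_subgroup \<open>m \<noteq> 0\<close> unfolding I_def by (rule pairing_not_Ints_of_separating)
    qed (use I commuting expanding p0 p1 in \<open>auto simp: I_def\<close>)
  qed
qed

end
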